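(* Let $L$ be an anti-selfdual Lagrangian on a reflexive Banach space $X$ such that $0\in\mathrm{Dom}(L)$ and $\mathrm{Dom}_1(L)$ is closed. Let $\Lambda:D(\Lambda)\subset X\to X^*$ be a bounded pseudo-regular map such that $\mathrm{Dom}_1(L)\subset D(\Lambda)$, $L$ is $\Lambda$-coercive, and, for some constant $C>0$, $$\langle\bar\partial L(x)+\Lambda x,x\rangle\ge-C(\|x\|+1)\quad\text{for large }\|x\|.$$ Then there exists $\bar u\in X$ such that $$L(\bar u,\Lambda\bar u)+\langle\Lambda\bar u,\bar u\rangle=\inf_{x\in X}\big\{L(x,\Lambda x)+\langle\Lambda x,x\rangle\big\}=0,$$ and $\bar u$ is a solution of the differential inclusion $-\Lambda\bar u\in\bar\partial L(\bar u)$.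
   Context: Anti-selfdual Lagrangian on $X$ (i.e. on $X\times X^*$): a convex lower semicontinuous $L:X\times X^*\to\mathbb R\cup\{+\infty\}$, not identically $+\infty$, with $L^*(p,x)=L(-x,-p)$ for all $(p,x)\in X^*\times X$, where $L^*(q,y)=\sup\{\langle q,x\rangle+\langle p,y\rangle-L(x,p);\,x\in X,p\in X^*\}$. $\mathrm{Dom}(L)=\{(x,p):L(x,p)<+\infty\}$, $\mathrm{Dom}_1(L)=\{x\in X: L(x,p)<+\infty\text{ for some }p\in X^*\}$, and $0\in\mathrm{Dom}(L)$ means $(0,0)\in\mathrm{Dom}(L)$. $\bar\partial L(x)=\{p\in X^*;\ L(x,-p)-\langle x,p\rangle=0\}$; an inequality involving $\bar\partial L(x)$ is required for every element of that (possibly empty) set. Expressions $L(x,\Lambda x)+\langle\Lambda x,x\rangle$ are taken to be $+\infty$ for $x\notin D(\Lambda)$. $\Lambda$ is bounded if it maps bounded sets to bounded sets. $\Lambda:D(\Lambda)\subset X\to X^*$ is pseudo-regular if whenever $(x_n)$ is a sequence in $D(\Lambda)$ with $x_n\rightharpoonup x\in D(\Lambda)$ weakly in $X$ and $\limsup_n\langle\Lambda x_n,x_n-x\rangle\le0$, then $\liminf_n\langle\Lambda x_n,x_n\rangle\ge\langle\Lambda x,x\rangle$ and $\Lambda x_n\rightharpoonup\Lambda x$ weakly in $X^*$. $J:X\to X^*$ is the duality map, uniquely determined by $\langle Ju,u\rangle=\|u\|^2$, $\|Ju\|_{X^*}=\|u\|$. $L$ is $\Lambda$-coercive if for every sequence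 $(x_n)_{n\ge1}$ in $D(\Lambda)$ with $\|x_n\|\to+\infty$, $L(x_n,\Lambda x_n+\frac1nJx_n)+\langle x_n,\Lambda x_n\rangle+\frac1n\|x_n\|^2\to+\infty$. *)

theory Defs
  imports "HOL-Analysis.Analysis"
begin

text \<open>
  The dual space of a real normed space \<open>'a\<close> is the type \<open>'a \<Rightarrow>\<^sub>L real\<close> with the operator norm, and the
  pairing of \<open>x\<close> with \<open>p\<close> is \<open>blinfun_apply p x\<close>.
\<close>

definition reflexive_space :: "'a::real_normed_vector itself \<Rightarrow> bool" where
  "reflexive_space _ \<longleftrightarrow> (\<forall>\<phi> :: ('a \<Rightarrow>\<^sub>L real) \<Rightarrow>\<^sub>L real. \<exists>x. \<forall>p :: 'a \<Rightarrow>\<^sub>L real. blinfun_apply \<phi> p = blinfun_apply p x)"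

definition weakly_tendsto :: "(nat \<Rightarrow> 'a::real_normed_vector) \<Rightarrow> 'a \<Rightarrow> bool" where
  "weakly_tendsto X l \<longleftrightarrow> (\<forall>f :: 'a \<Rightarrow>\<^sub>L real. (\<lambda>n. blinfun_apply f (X n)) \<longlonglongrightarrow> blinfun_apply f l)"

definition convex_fun :: "('v::real_vector \<Rightarrow> ereal) \<Rightarrow> bool" where
  "convex_fun f \<longleftrightarrow>
    (\<forall>u v t. 0 < t \<and> t < 1 \<longrightarrow>
      f (t *\<^sub>R u + (1 - t) *\<^sub>R v) \<le> ereal t * f u + ereal (1 - t) * f v)"

definition lsc_fun :: "('v::topological_space \<Rightarrow> ereal) \<Rightarrow> bool" where
  "lsc_fun f \<longleftrightarrow> (\<forall>z. f z \<le> Liminf (at z) f)"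

text \<open>
  The first argument of the conjugate lies in the dual and the second in the space itself,
  so reflexivity is used implicitly in identifying the bidual with the space.
\<close>

definition conjugate ::
    "('a::real_normed_vector \<times> ('a \<Rightarrow>\<^sub>L real) \<Rightarrow> ereal) \<Rightarrow> ('a \<Rightarrow>\<^sub>L real) \<times> 'a \<Rightarrow> ereal" where
  "conjugate L = (\<lambda>(q, y). SUP (x, p)\<in>UNIV. ereal (blinfun_apply q x + blinfun_apply p y) - L (x, p))"

definition antiselfdual_lagrangian ::
    "('a::real_normed_vector \<times> ('a \<Rightarrow>\<^sub>L real) \<Rightarrow> ereal) \<Rightarrow> bool" where
  "antiselfdual_lagrangian L \<longleftrightarrow>
    (\<forall>z. L z \<noteq> -\<infinity>) \<and> (\<exists>z. L z \<noteq> \<infinity>) \<and> convex_fun L \<and> lsc_fun L \<and>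
    (\<forall>p x. conjugate L (p, x) = L (-x, -p))"

definition Dom ::
    "('a::real_normed_vector \<times> ('a \<Rightarrow>\<^sub>L real) \<Rightarrow> ereal) \<Rightarrow> ('a \<times> ('a \<Rightarrow>\<^sub>L real)) set" where
  "Dom L = {(x, p). L (x, p) < \<infinity>}"

definition Dom1 :: "('a::real_normed_vector \<times> ('a \<Rightarrow>\<^sub>L real) \<Rightarrow> ereal) \<Rightarrow> 'a set" where
  "Dom1 L = {x. \<exists>p. L (x, p) < \<infinity>}"

definition bar_partial ::
    "('a::real_normed_vector \<times> ('a \<Rightarrow>\<^sub>L real) \<Rightarrow> ereal) \<Rightarrow> 'a \<Rightarrow> ('a \<Rightarrow>\<^sub>L real) set" where
  "bar_partial L x = {p. L (x, -p) - ereal (blinfun_apply p x) = 0}"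

text \<open>
  A partially defined map is a total function together with its domain \<open>D\<close>; its values
  outside \<open>D\<close> are never used.
\<close>

definition bounded_map ::
    "'a::real_normed_vector set \<Rightarrow> ('a \<Rightarrow> ('a \<Rightarrow>\<^sub>L real)) \<Rightarrow> bool" where
  "bounded_map D \<Lambda> \<longleftrightarrow> (\<forall>B. B \<subseteq> D \<and> bounded B \<longrightarrow> bounded (\<Lambda> ` B))"

definition pseudo_regular ::
    "'a::real_normed_vector set \<Rightarrow> ('a \<Rightarrow> ('a \<Rightarrow>\<^sub>L real)) \<Rightarrow> bool" where
  "pseudo_regular D \<Lambda> \<longleftrightarrow>
    (\<forall>X x. (\<forall>n. X n \<in> D) \<and> x \<in> D \<and> weakly_tendsto X x \<and>
        limsup (\<lambda>n. ereal (blinfun_apply (\<Lambda> (X n)) (X n - x))) \<le> 0 \<longrightarrow>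
      liminf (\<lambda>n. ereal (blinfun_apply (\<Lambda> (X n)) (X n))) \<ge> ereal (blinfun_apply (\<Lambda> x) x) \<and>
      weakly_tendsto (\<lambda>n. \<Lambda> (X n)) (\<Lambda> x))"

text \<open>
  The equivalence says that \<open>J u\<close> has the two defining properties and is the only functional
  that has them. The duality map being single-valued is thus part of the definition.
\<close>

definition is_duality_map :: "('a::real_normed_vector \<Rightarrow> ('a \<Rightarrow>\<^sub>L real)) \<Rightarrow> bool" where
  "is_duality_map J \<longleftrightarrow> (\<forall>u p. p = J u \<longleftrightarrow> blinfun_apply p u = (norm u)\<^sup>2 \<and> norm p = norm u)"

definition Lambda_coercive ::
    "('a::real_normed_vector \<Rightarrow> ('a \<Rightarrow>\<^sub>L real)) \<Rightarrow> 'a set \<Rightarrow> ('a \<Rightarrow> ('a \<Rightarrow>\<^sub>L real)) \<Rightarrow>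
      ('a \<times> ('a \<Rightarrow>\<^sub>L real) \<Rightarrow> ereal) \<Rightarrow> bool" where
  "Lambda_coercive J D \<Lambda> L \<longleftrightarrow>
    (\<forall>X. (\<forall>n\<ge>1. X n \<in> D) \<and> filterlim (\<lambda>n. norm (X n)) at_top sequentially \<longrightarrow>
      (\<lambda>n. L (X n, \<Lambda> (X n) + (1 / real n) *\<^sub>R J (X n)) +
            ereal (blinfun_apply (\<Lambda> (X n)) (X n) + (1 / real n) * (norm (X n))\<^sup>2)) \<longlonglongrightarrow> \<infinity>)"

definition energy ::
    "'a::real_normed_vector set \<Rightarrow> ('a \<Rightarrow> ('a \<Rightarrow>\<^sub>L real)) \<Rightarrow>
      ('a \<times> ('a \<Rightarrow>\<^sub>L real) \<Rightarrow> ereal) \<Rightarrow> 'a \<Rightarrow> ereal" where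
  "energy D \<Lambda> L x = (if x \<in> D then L (x, \<Lambda> x) + ereal (blinfun_apply (\<Lambda> x) x) else \<infinity>)"

end

theory Submission
  imports Defs
begin

text \<open>
  The energy is nonnegative and vanishes exactly at the solutions of \<open>- \<Lambda> u \<in> bar_partial L u\<close>, and
  anti-selfduality makes the graph of \<open>bar_partial L\<close> monotone with surjective resolvents. The
  inclusion is first solved for \<open>\<Lambda> + J / n\<close>, cut off and penalized outside a large ball: a finite Ky Fan
  inequality (from Brouwer's theorem) gives Galerkin approximations along a countable set, whose
  weak limit is identified by testing with resolvents and by pseudo-regularity, while the growth
  condition on \<open>bar_partial L + \<Lambda>\<close> keeps the solution inside the ball. Coercivity bounds these
  solutions uniformly in \<open>n\<close>, and a weak limit of them is the required point.
\<close>

section \<open>Hahn--Banach and separation\<close>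

text \<open>Membership of \<open>(x, - T x)\<close> in the graph means
  \<open>L (x, T x) + <T x, x> <= 0\<close>, and by anti-selfduality the left side is the supremum
  over \<open>(y, q)\<close> of \<open><T x, x - y> - <q, x> - L (y, q)\<close>. The inclusion thus
  becomes a family of scalar constraints, any finite number of which can be met by Ky Fan. The
  obstacle is the passage to all of them: pseudo-regularity speaks of sequences only and the space
  is not assumed separable, so neither nets of finite sets nor a dense sequence are at hand. The
  constraints are therefore restricted to a countable set, which must contain test points adapted to
  a limit not known in advance. Resolvents at the limit are the ideal test points, since they add a
  square to the good side of the limit inequality; nearby resolvents are as good up to a vanishing
  error. The term \<open>J / n\<close> supplies positivity where the cut-off removes
  \<open>\<Lambda>\<close>, and it beats the linear growth bound because its pairing with
  \<open>x\<close> is quadratic.\<close>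

definition sublinear :: "('v::real_vector \<Rightarrow> real) \<Rightarrow> bool" where
  "sublinear S \<longleftrightarrow> (\<forall>x y. S (x + y) \<le> S x + S y) \<and> (\<forall>t x. 0 < t \<longrightarrow> S (t *\<^sub>R x) \<le> t * S x)"

lemma sublinear_add: "sublinear S \<Longrightarrow> S (x + y) \<le> S x + S y"
  by (simp add: sublinear_def)

lemma sublinear_scaleR_le: "sublinear S \<Longrightarrow> 0 < t \<Longrightarrow> S (t *\<^sub>R x) \<le> t * S x"
  by (simp add: sublinear_def)

lemma sublinear_zero: "sublinear S \<Longrightarrow> S 0 = 0"
  using sublinear_scaleR_le[of S 2 0] sublinear_scaleR_le[of S "1/2" 0] by simp

text \<open>Homogeneity is demanded as an inequality for positive factors because functionals
  defined as infima satisfy that directly; applying it to \<open>t\<close> and to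
  \<open>1 / t\<close> recovers equality.\<close>

lemma sublinear_scaleR:
  assumes "sublinear S" "0 \<le> t"
  shows "S (t *\<^sub>R x) = t * S x"
proof (cases "t = 0")
  case True
  then show ?thesis using sublinear_zero[OF assms(1)] by simp
next
  case False
  then have "t > 0" using assms by simp
  have "S ((1/t) *\<^sub>R (t *\<^sub>R x)) \<le> (1/t) * S (t *\<^sub>R x)"
    by (rule sublinear_scaleR_le[OF assms(1)]) (use \<open>t > 0\<close> in simp)
  then have "t * S x \<le> S (t *\<^sub>R x)" using \<open>t > 0\<close> by (simp add: field_simps)
  then show ?thesis using sublinear_scaleR_le[OF assms(1) \<open>t > 0\<close>, of x] by simp
qed

lemma sublinear_minus_le: "sublinear S \<Longrightarrow> - S (- x) \<le> S x"
  using sublinear_add[of S x "- x"] sublinear_zero[of S] by simp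

lemma le_INF_add_INF:
  fixes f :: "'i \<Rightarrow> real" and g :: "'j \<Rightarrow> real"
  assumes "A \<noteq> {}" "B \<noteq> {}" "\<And>s t. s \<in> A \<Longrightarrow> t \<in> B \<Longrightarrow> c \<le> f s + g t"
  shows "c \<le> (INF s\<in>A. f s) + (INF t\<in>B. g t)"
proof -
  have "c - (INF s\<in>A. f s) \<le> (INF t\<in>B. g t)"
  proof (rule cINF_greatest[OF assms(2)])
    fix t assume t: "t \<in> B"
    have "c - g t \<le> (INF s\<in>A. f s)"
    proof (rule cINF_greatest[OF assms(1)])
      fix s assume "s \<in> A"
      then show "c - g t \<le> f s" using assms(3)[of s t] t by simp
    qed
    then show "c - (INF s\<in>A. f s) \<le> g t" by simp
  qed
  then show ?thesis by simp
qed

text \<open>Sliding along the ray of \<open>a\<close> and subtracting the cost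
  \<open>t * S a\<close> lowers \<open>S\<close> towards a functional additive in direction
  \<open>a\<close>. The choice \<open>t = 0\<close> gives the bound by \<open>S\<close>, and
  \<open>t = 1\<close> the last two properties: one is exactness at \<open>- a\<close>, the other
  forces superadditivity on a minimal functional.\<close>

lemma sublinear_tilt:
  fixes S :: "'v::real_vector \<Rightarrow> real"
  assumes S: "sublinear S"
  obtains S' where "sublinear S'" "\<And>x. S' x \<le> S x" "S' (- a) \<le> - S a"
    "\<And>x. S' x \<le> S (x + a) - S a"
proof -
  define h where "h x t = S (x + t *\<^sub>R a) - t * S a" for x t
  define S' where "S' x = (INF t\<in>{0..}. h x t)" for x
  have bdd: "bdd_below (h x ` {0..})" for x
  proof (rule bdd_belowI2)
    fix t :: real assume "t \<in> {0..}"
    then have "t * S a \<le> S (x + t *\<^sub>R a) + S (- x)"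
      using sublinear_add[OF S, of "x + t *\<^sub>R a" "- x"] sublinear_scaleR[OF S, of t a] by simp
    then show "- S (- x) \<le> h x t" by (simp add: h_def)
  qed
  have le: "S' x \<le> h x t" if "0 \<le> t" for x t
    unfolding S'_def by (rule cINF_lower[OF bdd]) (use that in auto)
  have "S' (x + y) \<le> S' x + S' y" for x y
    unfolding S'_def[of x] S'_def[of y]
  proof (rule le_INF_add_INF)
    fix s t :: real assume st: "s \<in> {0..}" "t \<in> {0..}"
    have "S' (x + y) \<le> h (x + y) (s + t)" using st by (intro le) auto
    also have "\<dots> \<le> h x s + h y t"
      using sublinear_add[OF S, of "x + s *\<^sub>R a" "y + t *\<^sub>R a"]
      by (simp add: h_def algebra_simps)
    finally show "S' (x + y) \<le> h x s + h y t" .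
  qed auto
  moreover have "S' (r *\<^sub>R x) \<le> r * S' x" if r: "0 < r" for r x
  proof -
    have "S' (r *\<^sub>R x) / r \<le> S' x"
      unfolding S'_def[of x]
    proof (rule cINF_greatest)
      fix t :: real assume t: "t \<in> {0..}"
      have "S' (r *\<^sub>R x) \<le> h (r *\<^sub>R x) (r * t)" using t r by (intro le) auto
      also have "\<dots> = r * h x t"
        using sublinear_scaleR[OF S, of r "x + t *\<^sub>R a"] r by (simp add: h_def algebra_simps)
      finally show "S' (r *\<^sub>R x) / r \<le> h x t" using r by (simp add: field_simps)
    qed auto
    then show ?thesis using r by (simp add: field_simps)
  qed
  ultimately have "sublinear S'" by (simp add: sublinear_def)
  moreover have "S' x \<le> S x" for x using le[of 0 x] by (simp add: h_def)
  moreover have "S' (- a) \<le> - S a" using le[of 1 "- a"] sublinear_zero[OF S] by (simp add: h_def)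
  moreover have "S' x \<le> S (x + a) - S a" for x using le[of 1 x] by (simp add: h_def)
  ultimately show ?thesis by (rule that)
qed

lemma minimal_sublinear_exists:
  fixes S :: "'v::real_vector \<Rightarrow> real"
  assumes S: "sublinear S"
  obtains l where "sublinear l" "l \<le> S" "\<And>l'. sublinear l' \<Longrightarrow> l' \<le> l \<Longrightarrow> l' = l"
proof -
  define A where "A = {l. sublinear l \<and> l \<le> S}"
  \<comment> \<open>The order is reversed, so that Zorn's maximal element is pointwise
    minimal.\<close>
  define P where "P = (\<lambda>f g :: 'v \<Rightarrow> real. g \<le> f)"
  have "\<exists>m\<in>A. \<forall>a\<in>A. P m a \<longrightarrow> a = m"
  proof (rule predicate_Zorn)
    show "partial_order_on A (relation_of P A)"
      by (auto simp: partial_order_on_def preorder_on_def refl_on_def trans_def antisym_def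
          relation_of_def P_def)
  next
    fix C assume C: "C \<in> Chains (relation_of P A)"
    have CA: "C \<subseteq> A" and tot: "\<And>f g. f \<in> C \<Longrightarrow> g \<in> C \<Longrightarrow> f \<le> g \<or> g \<le> f"
      using C by (auto simp: Chains_def relation_of_def P_def)
    show "\<exists>u\<in>A. \<forall>a\<in>C. P a u"
    proof (cases "C = {}")
      case True
      then show ?thesis using S by (auto simp: A_def)
    next
      case False
      define u where "u x = (INF f\<in>C. f x)" for x
      \<comment> \<open>Every sublinear \<open>f <= S\<close> satisfies
        \<open>- S (- x) <= - f (- x) <= f x\<close>, so the infimum over a chain stays
        real.\<close>
      have bdd: "bdd_below ((\<lambda>f. f x) ` C)" for x
      proof (rule bdd_belowI2)
        fix f assume "f \<in> C"
        then have "sublinear f" "f \<le> S" using CA by (auto simp: A_def)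
        then show "- S (- x) \<le> f x" using sublinear_minus_le[of f x] le_funD[of f S "- x"] by simp
      qed
      have le: "u x \<le> f x" if "f \<in> C" for f x
        unfolding u_def by (rule cINF_lower[OF bdd that])
      have "u (x + y) \<le> u x + u y" for x y
        unfolding u_def[of x] u_def[of y]
      proof (rule le_INF_add_INF[OF False False])
        fix f g assume fg: "f \<in> C" "g \<in> C"
        then have "sublinear f" "sublinear g" using CA by (auto simp: A_def)
        from tot[OF fg] show "u (x + y) \<le> f x + g y"
        proof
          assume "f \<le> g"
          then show ?thesis
            using le[OF fg(1), of "x + y"] sublinear_add[OF \<open>sublinear f\<close>, of x y] le_funD[of f g y] by simp
        next
          assume "g \<le> f"
          then show ?thesis
            using le[OF fg(2), of "x + y"] sublinear_add[OF \<open>sublinear g\<close>, of x y] le_funD[of g f x] by simp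
        qed
      qed
      moreover have "u (r *\<^sub>R x) \<le> r * u x" if r: "0 < r" for r x
      proof -
        have "u (r *\<^sub>R x) / r \<le> u x"
          unfolding u_def[of x]
        proof (rule cINF_greatest[OF False])
          fix f assume f: "f \<in> C"
          then have "sublinear f" using CA by (auto simp: A_def)
          then show "u (r *\<^sub>R x) / r \<le> f x"
            using le[OF f, of "r *\<^sub>R x"] sublinear_scaleR_le[of f r x] r by (simp add: field_simps)
        qed
        then show ?thesis using r by (simp add: field_simps)
      qed
      ultimately have "sublinear u" by (simp add: sublinear_def)
      moreover have "u \<le> S"
      proof -
        obtain f where f: "f \<in> C" using False by auto
        then have "f \<le> S" using CA by (auto simp: A_def)
        then show ?thesis using le[OF f] by (auto simp: le_fun_def intro: order_trans)
      qed
      ultimately show ?thesis using le by (auto simp: A_def P_def le_fun_def)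
    qed
  qed
  then obtain m where m: "m \<in> A" "\<And>a. a \<in> A \<Longrightarrow> a \<le> m \<Longrightarrow> a = m" by (auto simp: P_def)
  show ?thesis
  proof (rule that[of m])
    show "sublinear m" "m \<le> S" using m(1) by (auto simp: A_def)
    fix l' assume "sublinear l'" "l' \<le> m"
    then show "l' = m" using m by (auto simp: A_def)
  qed
qed

text \<open>A minimal sublinear functional coincides with each of its tilts, and the last property
  of a tilt then reads as superadditivity.\<close>

lemma sublinear_dominates_linear:
  fixes S :: "'v::real_vector \<Rightarrow> real"
  assumes S: "sublinear S"
  obtains l where "linear l" "\<And>x. l x \<le> S x"
proof -
  obtain l where l: "sublinear l" "l \<le> S" and min: "\<And>l'. sublinear l' \<Longrightarrow> l' \<le> l \<Longrightarrow> l' = l"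
    using minimal_sublinear_exists[OF S] by metis
  have sup: "l x + l a \<le> l (x + a)" for x a
  proof -
    obtain l' where "sublinear l'" "\<And>x. l' x \<le> l x" "\<And>x. l' x \<le> l (x + a) - l a"
      using sublinear_tilt[OF l(1), of a] by metis
    with min[of l'] have "l x \<le> l (x + a) - l a" by (auto simp: le_fun_def)
    then show ?thesis by simp
  qed
  have add: "l (x + y) = l x + l y" for x y
    using sup[of x y] sublinear_add[OF l(1), of x y] by simp
  have neg: "l (- x) = - l x" for x
    using add[of x "- x"] sublinear_zero[OF l(1)] by simp
  have "l (r *\<^sub>R x) = r * l x" for r x
  proof (cases "0 \<le> r")
    case True then show ?thesis using sublinear_scaleR[OF l(1)] by blast
  next
    case False
    then show ?thesis using sublinear_scaleR[OF l(1), of "- r" x] neg[of "r *\<^sub>R x"] by simp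
  qed
  then have "linear l" using add by (intro linearI) auto
  then show ?thesis using that l(2) by (auto simp: le_fun_def)
qed

theorem Hahn_Banach_sublinear:
  fixes S :: "'v::real_vector \<Rightarrow> real"
  assumes S: "sublinear S"
  obtains l where "linear l" "\<And>x. l x \<le> S x" "l a = S a"
proof -
  \<comment> \<open>Tilting first yields exactness at \<open>a\<close>: from
    \<open>l (- a) <= - S a\<close> follows \<open>S a <= l a\<close>.\<close>
  obtain S' where S': "sublinear S'" "\<And>x. S' x \<le> S x" "S' (- a) \<le> - S a"
    using sublinear_tilt[OF S, of a] by metis
  obtain l where l: "linear l" "\<And>x. l x \<le> S' x" using sublinear_dominates_linear[OF S'(1)] by metis
  have "l x \<le> S x" for x using l(2)[of x] S'(2)[of x] by simp
  moreover have "l a = S a"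
    using calculation[of a] l(2)[of "- a"] S'(3) linear_neg[OF l(1), of a] by simp
  ultimately show ?thesis using that l(1) by blast
qed

text \<open>
  The algebraic core of Fenchel duality: the functional separates the epigraph of \<open>f\<close> from the
  hypograph of \<open>b - g\<close>. It is dominated by the infimal value of \<open>r (f z + g w - b)\<close> over all
  representations \<open>v = r (w - z)\<close>.
\<close>

lemma convex_sandwich_linear:
  fixes f g :: "'v::real_vector \<Rightarrow> real"
  assumes f: "convex_on C f" and "C \<noteq> {}" and g: "convex_on UNIV g"
    and b: "\<And>z. z \<in> C \<Longrightarrow> b \<le> f z + g z"
  obtains l where "linear l" "\<And>z w. z \<in> C \<Longrightarrow> l (w - z) \<le> f z + g w - b"
proof -
  define R where "R v = {(r, z, w). 0 < r \<and> z \<in> C \<and> v = r *\<^sub>R (w - z)}" for v :: 'v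
  define k where "k = (\<lambda>(r, z, w). r * (f z + g w - b))"
  define T where "T v = (INF s\<in>R v. k s)" for v
  have fD: "f (s *\<^sub>R x + t *\<^sub>R y) \<le> s * f x + t * f y"
    if "x \<in> C" "y \<in> C" "0 \<le> s" "0 \<le> t" "s + t = 1" for x y s t
    using f that unfolding convex_on_def by blast
  have gD: "g (s *\<^sub>R x + t *\<^sub>R y) \<le> s * g x + t * g y"
    if "0 \<le> s" "0 \<le> t" "s + t = 1" for x y s t
    using g that unfolding convex_on_def by blast
  have convC: "convex C" using f by (simp add: convex_on_def)
  obtain z0 where z0: "z0 \<in> C" using \<open>C \<noteq> {}\<close> by auto
  have Rne: "R v \<noteq> {}" for v
  proof -
    have "(1, z0, z0 + v) \<in> R v" using z0 by (simp add: R_def)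
    then show ?thesis by blast
  qed
  \<comment> \<open>Two representations merge with weights \<open>r / q\<close> and
    \<open>r' / q\<close>, where \<open>q = r + r'\<close>; convexity of \<open>f\<close> and
    \<open>g\<close> bounds the merged value by the sum.\<close>
  have comb: "\<exists>s3\<in>R (v1 + v2). k s3 \<le> k s1 + k s2" if s: "s1 \<in> R v1" "s2 \<in> R v2" for s1 s2 v1 v2
  proof -
    obtain r z w where 1: "s1 = (r, z, w)" "0 < r" "z \<in> C" "v1 = r *\<^sub>R (w - z)"
      using s(1) by (auto simp: R_def)
    obtain r' z' w' where 2: "s2 = (r', z', w')" "0 < r'" "z' \<in> C" "v2 = r' *\<^sub>R (w' - z')"
      using s(2) by (auto simp: R_def)
    define q where "q = r + r'"
    have q: "q > 0" using 1 2 by (simp add: q_def)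
    have sum1: "r / q + r' / q = 1" using q by (simp add: q_def add_divide_distrib[symmetric])
    define zz where "zz = (r / q) *\<^sub>R z + (r' / q) *\<^sub>R z'"
    define ww where "ww = (r / q) *\<^sub>R w + (r' / q) *\<^sub>R w'"
    have "zz \<in> C" unfolding zz_def using 1 2 q sum1 by (intro convexD[OF convC]) auto
    moreover have qzz: "q *\<^sub>R zz = r *\<^sub>R z + r' *\<^sub>R z'" "q *\<^sub>R ww = r *\<^sub>R w + r' *\<^sub>R w'"
      using q by (simp_all add: zz_def ww_def scaleR_add_right)
    have "q *\<^sub>R (ww - zz) = v1 + v2"
      using qzz 1(4) 2(4) by (simp only: scaleR_diff_right) simp
    ultimately have inR: "(q, zz, ww) \<in> R (v1 + v2)" using q by (simp add: R_def)
    have fz: "f zz \<le> (r / q) * f z + (r' / q) * f z'"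
      unfolding zz_def using 1 2 q sum1 by (intro fD) auto
    have gw: "g ww \<le> (r / q) * g w + (r' / q) * g w'"
      unfolding ww_def using 1 2 q sum1 by (intro gD) auto
    have "q * f zz \<le> r * f z + r' * f z'" "q * g ww \<le> r * g w + r' * g w'"
      using mult_left_mono[OF fz, of q] mult_left_mono[OF gw, of q] q by (simp_all add: algebra_simps)
    then have "k (q, zz, ww) \<le> k s1 + k s2"
      unfolding 1 2 k_def by (simp add: algebra_simps q_def)
    with inR show ?thesis by blast
  qed
  \<comment> \<open>A representation of 0 has \<open>w = z\<close> because \<open>r > 0\<close>, so
    the hypothesis on \<open>b\<close> applies. Adding a fixed representation of \<open>- v\<close>
    carries the lower bound to every \<open>v\<close>.\<close>
  have k0: "0 \<le> k s" if "s \<in> R 0" for s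
    using that b by (auto simp: R_def k_def)
  have bdd: "bdd_below (k ` R v)" for v
  proof -
    obtain s' where s': "s' \<in> R (- v)" using Rne by blast
    show ?thesis
    proof (rule bdd_belowI2)
      fix s assume "s \<in> R v"
      from comb[OF this s'] obtain s3 where "s3 \<in> R 0" "k s3 \<le> k s + k s'" by auto
      with k0[of s3] show "- k s' \<le> k s" by simp
    qed
  qed
  have le: "T v \<le> k s" if "s \<in> R v" for v s
    unfolding T_def by (rule cINF_lower[OF bdd that])
  have "T (x + y) \<le> T x + T y" for x y
    unfolding T_def[of x] T_def[of y]
  proof (rule le_INF_add_INF[OF Rne Rne])
    fix s t assume "s \<in> R x" "t \<in> R y"
    from comb[OF this] le show "T (x + y) \<le> k s + k t" by (meson order_trans)
  qed
  moreover have "T (r *\<^sub>R x) \<le> r * T x" if r: "0 < r" for r x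
  proof -
    have "T (r *\<^sub>R x) / r \<le> T x"
      unfolding T_def[of x]
    proof (rule cINF_greatest[OF Rne])
      fix s assume "s \<in> R x"
      then obtain q z w where s: "s = (q, z, w)" "0 < q" "z \<in> C" "x = q *\<^sub>R (w - z)"
        by (auto simp: R_def)
      then have "(r * q, z, w) \<in> R (r *\<^sub>R x)" using r by (simp add: R_def)
      from le[OF this] have "T (r *\<^sub>R x) \<le> r * k s"
        by (simp add: k_def s(1) mult.assoc)
      then show "T (r *\<^sub>R x) / r \<le> k s" using r by (simp add: field_simps)
    qed
    then show ?thesis using r by (simp add: field_simps)
  qed
  ultimately have "sublinear T" by (simp add: sublinear_def)
  then obtain l where l: "linear l" "\<And>x. l x \<le> T x"
    using sublinear_dominates_linear by metis
  have "l (w - z) \<le> f z + g w - b" if "z \<in> C" for z w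
  proof -
    have "(1, z, w) \<in> R (w - z)" using that by (simp add: R_def)
    from le[OF this] l(2)[of "w - z"] show ?thesis by (simp add: k_def)
  qed
  with l(1) show ?thesis using that by blast
qed

section \<open>Bounded functionals: separation and norming\<close>

lemma bounded_linear_if_bounded_above:
  fixes l :: "'v::real_normed_vector \<Rightarrow> real"
  assumes l: "linear l" and "0 < r" and M: "\<And>x. norm x \<le> r \<Longrightarrow> l x \<le> M"
  shows "bounded_linear l" "\<And>x. l x \<le> (M / r) * norm x"
proof -
  show le: "l x \<le> (M / r) * norm x" for x
  proof (cases "x = 0")
    case True then show ?thesis using linear_0[OF l] by simp
  next
    case False
    have "l ((r / norm x) *\<^sub>R x) \<le> M" using False \<open>0 < r\<close> by (intro M) auto
    then have "(r / norm x) * l x \<le> M" by (simp add: linear_cmul[OF l])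
    then show ?thesis using False \<open>0 < r\<close> by (simp add: field_simps)
  qed
  have "\<bar>l x\<bar> \<le> norm x * (M / r)" for x
    using le[of x] le[of "- x"] linear_neg[OF l, of x] by (simp add: abs_le_iff mult.commute)
  then show "bounded_linear l"
    by (intro bounded_linear.intro l bounded_linear_axioms.intro exI[of _ "M / r"]) auto
qed

text \<open>The sandwich is applied to the zero function on \<open>C\<close> and the distance to
  \<open>a\<close>, whose sum is at least \<open>infdist a C\<close> on \<open>C\<close>; evaluating
  at \<open>w = a\<close> leaves this gap as the margin \<open>d\<close>.\<close>

lemma closed_convex_separation:
  fixes a :: "'v::real_normed_vector"
  assumes "closed C" "convex C" "C \<noteq> {}" "a \<notin> C"
  obtains p :: "'v \<Rightarrow>\<^sub>L real" and d where "d > 0" "\<And>z. z \<in> C \<Longrightarrow> blinfun_apply p a + d \<le> blinfun_apply p z"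
proof -
  define d where "d = infdist a C"
  have d: "d > 0" using assms by (simp add: d_def infdist_pos_not_in_closed)
  have dle: "d \<le> 0 + norm (z - a)" if "z \<in> C" for z
    using infdist_le[OF that, of a] by (simp add: d_def dist_norm norm_minus_commute)
  have cnorm: "convex_on UNIV (\<lambda>w. norm (w - a))"
    using convex_on_dist[of UNIV a] by (simp add: dist_norm norm_minus_commute)
  obtain l where l: "linear l" "\<And>z w. z \<in> C \<Longrightarrow> l (w - z) \<le> 0 + norm (w - a) - d"
    using convex_sandwich_linear[of C "\<lambda>_. 0" "\<lambda>w. norm (w - a)" d] assms cnorm dle
    by (auto simp: convex_on_def)
  obtain z0 where z0: "z0 \<in> C" using assms by auto
  have "l x \<le> 1 + norm (z0 - a)" if "norm x \<le> 1" for x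
  proof -
    have "l x \<le> norm (x + z0 - a) - d" using l(2)[OF z0, of "x + z0"] by simp
    also have "\<dots> \<le> norm x + norm (z0 - a)" using norm_triangle_ineq[of x "z0 - a"] d by (simp add: algebra_simps)
    finally show ?thesis using that by simp
  qed
  from bounded_linear_if_bounded_above(1)[OF l(1) zero_less_one this]
  have bl: "bounded_linear l" .
  show ?thesis
  proof (rule that[of d "Blinfun l"])
    fix z assume "z \<in> C"
    from l(2)[OF this, of a] show "blinfun_apply (Blinfun l) a + d \<le> blinfun_apply (Blinfun l) z"
      by (simp add: bounded_linear_Blinfun_apply[OF bl] linear_diff[OF l(1)])
  qed (rule d)
qed

lemma norming_functional:
  fixes a :: "'v::real_normed_vector"
  obtains p :: "'v \<Rightarrow>\<^sub>L real" where "norm p \<le> 1" "blinfun_apply p a = norm a"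
proof -
  have "sublinear (norm :: 'v \<Rightarrow> real)" by (simp add: sublinear_def norm_triangle_ineq)
  then obtain l where l: "linear l" "\<And>x. l x \<le> norm x" "l a = norm a"
    using Hahn_Banach_sublinear[of norm a] by metis
  have bl: "bounded_linear l"
    by (rule bounded_linear_if_bounded_above(1)[OF l(1) zero_less_one, of 1]) (use l(2) order_trans in blast)
  have "\<bar>l x\<bar> \<le> norm x" for x using l(2)[of x] l(2)[of "- x"] linear_neg[OF l(1), of x] by simp
  then have "norm (Blinfun l) \<le> 1"
    by (intro norm_blinfun_bound) (auto simp: bounded_linear_Blinfun_apply[OF bl])
  then show ?thesis using that l(3) by (simp add: bounded_linear_Blinfun_apply[OF bl])
qed

section \<open>Weak sequential compactness\<close>

definition rational_span :: "'v::real_vector set \<Rightarrow> 'v set" where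
  "rational_span A = (\<lambda>xs. \<Sum>(r, a)\<leftarrow>xs. r *\<^sub>R a) ` lists (\<rat> \<times> A)"

lemma countable_rational_span: "countable A \<Longrightarrow> countable (rational_span A)"
  unfolding rational_span_def by (intro countable_image countable_lists countable_SIGMA countable_rat)

lemma rational_span_superset: "A \<subseteq> rational_span A"
proof
  fix a assume "a \<in> A"
  then show "a \<in> rational_span A"
    unfolding rational_span_def by (intro image_eqI[of _ _ "[(1, a)]"]) auto
qed

lemma rational_span_add:
  assumes "x \<in> rational_span A" "y \<in> rational_span A"
  shows "x + y \<in> rational_span A"
proof -
  obtain xs ys where "xs \<in> lists (\<rat> \<times> A)" "x = (\<Sum>(r, a)\<leftarrow>xs. r *\<^sub>R a)"
    "ys \<in> lists (\<rat> \<times> A)" "y = (\<Sum>(r, a)\<leftarrow>ys. r *\<^sub>R a)"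
    using assms by (auto simp: rational_span_def)
  then show ?thesis
    unfolding rational_span_def by (intro image_eqI[of _ _ "xs @ ys"]) auto
qed

lemma rational_span_scale:
  assumes "x \<in> rational_span A" "q \<in> \<rat>"
  shows "q *\<^sub>R x \<in> rational_span A"
proof -
  obtain xs where xs: "xs \<in> lists (\<rat> \<times> A)" "x = (\<Sum>(r, a)\<leftarrow>xs. r *\<^sub>R a)"
    using assms by (auto simp: rational_span_def)
  have "q *\<^sub>R (\<Sum>(r, a)\<leftarrow>zs. r *\<^sub>R a) = (\<Sum>(r, a)\<leftarrow>map (\<lambda>(r, a). (q * r, a)) zs. r *\<^sub>R a)"
    for zs :: "(real \<times> 'a) list"
    by (induction zs) (auto simp: scaleR_add_right)
  then show ?thesis
    unfolding rational_span_def using xs assms(2)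
    by (intro image_eqI[of _ _ "map (\<lambda>(r, a). (q * r, a)) xs"]) (auto intro!: Rats_mult)
qed

lemma rational_span_mono: "A \<subseteq> B \<Longrightarrow> rational_span A \<subseteq> rational_span B"
  unfolding rational_span_def by (intro image_mono lists_mono) auto

lemma rational_span_finite_support:
  assumes "x \<in> rational_span A"
  obtains F where "finite F" "F \<subseteq> A" "x \<in> rational_span F"
proof -
  obtain xs where xs: "xs \<in> lists (\<rat> \<times> A)" "x = (\<Sum>(r, a)\<leftarrow>xs. r *\<^sub>R a)"
    using assms by (auto simp: rational_span_def)
  have "xs \<in> lists (\<rat> \<times> snd ` set xs)" using xs(1) by force
  then have "x \<in> rational_span (snd ` set xs)"
    unfolding rational_span_def using xs by blast
  moreover have "snd ` set xs \<subseteq> A" using xs(1) by auto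
  ultimately show ?thesis by (intro that[of "snd ` set xs"]) simp_all
qed

lemma subspace_closure_rational_span:
  fixes A :: "'v::real_normed_vector set"
  shows "subspace (closure (rational_span A))"
  unfolding subspace_def
proof (intro conjI ballI allI)
  have "0 \<in> rational_span A" unfolding rational_span_def by (intro image_eqI[of _ _ "[]"]) auto
  then show "0 \<in> closure (rational_span A)" using closure_subset by blast
next
  fix x y assume "x \<in> closure (rational_span A)" "y \<in> closure (rational_span A)"
  then obtain s t where "\<And>n. s n \<in> rational_span A" "s \<longlonglongrightarrow> x" "\<And>n. t n \<in> rational_span A" "t \<longlonglongrightarrow> y"
    by (auto simp: closure_sequential)
  then show "x + y \<in> closure (rational_span A)"
    unfolding closure_sequential
    by (intro exI[of _ "\<lambda>n. s n + t n"]) (auto intro: tendsto_intros rational_span_add)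
next
  fix c :: real and x assume "x \<in> closure (rational_span A)"
  then obtain s where s: "\<And>n. s n \<in> rational_span A" "s \<longlonglongrightarrow> x" by (auto simp: closure_sequential)
  have "c \<in> closure \<rat>" by (simp add: Rats_closure_real)
  then obtain q where q: "\<And>n. q n \<in> \<rat>" "q \<longlonglongrightarrow> c" by (auto simp: closure_sequential)
  show "c *\<^sub>R x \<in> closure (rational_span A)"
    unfolding closure_sequential
    by (intro exI[of _ "\<lambda>n. q n *\<^sub>R s n"]) (use s q in \<open>auto intro: tendsto_intros rational_span_scale\<close>)
qed

text \<open>Mazur's theorem: a separating functional would keep its values at all \<open>X n\<close>
  at least \<open>d\<close> above its value at the limit. It serves for \<open>Dom1 L\<close> and,
  in a product space, to trade a weak limit for strong limits of rational combinations.\<close>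

lemma weakly_tendsto_in_closed_convex:
  assumes "closed C" "convex C" "\<And>n. X n \<in> C" "weakly_tendsto X x"
  shows "x \<in> C"
proof (rule ccontr)
  assume "x \<notin> C"
  moreover have "C \<noteq> {}" using assms(3) by auto
  ultimately obtain p :: "'a \<Rightarrow>\<^sub>L real" and d where d: "d > 0"
    "\<And>z. z \<in> C \<Longrightarrow> blinfun_apply p x + d \<le> blinfun_apply p z"
    using closed_convex_separation[OF assms(1,2)] by metis
  have "(\<lambda>n. blinfun_apply p (X n)) \<longlonglongrightarrow> blinfun_apply p x"
    using assms(4) by (simp add: weakly_tendsto_def)
  then have "blinfun_apply p x + d \<le> blinfun_apply p x"
    by (rule LIMSEQ_le_const) (use d assms(3) in blast)
  then show False using d by simp
qed

lemma weakly_tendsto_norm_le: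
  assumes "weakly_tendsto X x" "(\<lambda>n. norm (X n)) \<longlonglongrightarrow> r"
  shows "norm x \<le> r"
proof -
  obtain p :: "'a \<Rightarrow>\<^sub>L real" where p: "norm p \<le> 1" "blinfun_apply p x = norm x"
    by (rule norming_functional)
  have "blinfun_apply p y \<le> norm y" for y
    using norm_blinfun[of p y] mult_right_mono[OF p(1), of "norm y"] by auto
  moreover have "(\<lambda>n. blinfun_apply p (X n)) \<longlonglongrightarrow> norm x"
    using assms(1) p(2) by (metis weakly_tendsto_def)
  ultimately show ?thesis using assms(2) by (auto intro: LIMSEQ_le)
qed

lemma weakly_tendsto_subseq:
  "weakly_tendsto X x \<Longrightarrow> strict_mono r \<Longrightarrow> weakly_tendsto (X \<circ> r) x"
  unfolding weakly_tendsto_def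
  by (auto intro: LIMSEQ_subseq_LIMSEQ[unfolded comp_def])

lemma weakly_tendsto_Pair:
  assumes "weakly_tendsto X x" "weakly_tendsto P p"
  shows "weakly_tendsto (\<lambda>n. (X n, P n)) (x, p)"
  unfolding weakly_tendsto_def
proof
  fix f :: "('a \<times> 'b) \<Rightarrow>\<^sub>L real"
  have b1: "bounded_linear (\<lambda>x::'a. (x, 0::'b))" and b2: "bounded_linear (\<lambda>x::'b. (0::'a, x))"
    by (auto intro: bounded_linear_Pair bounded_linear_ident bounded_linear_zero)
  define f1 where "f1 = f o\<^sub>L Blinfun (\<lambda>x. (x, 0))"
  define f2 where "f2 = f o\<^sub>L Blinfun (\<lambda>x. (0, x))"
  have split: "blinfun_apply f (y, q) = blinfun_apply f1 y + blinfun_apply f2 q" for y q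
    unfolding f1_def f2_def
    by (simp add: bounded_linear_Blinfun_apply[OF b1] bounded_linear_Blinfun_apply[OF b2] flip: blinfun.add_right)
  show "(\<lambda>n. blinfun_apply f (X n, P n)) \<longlonglongrightarrow> blinfun_apply f (x, p)"
    unfolding split using assms by (intro tendsto_add) (auto simp: weakly_tendsto_def)
qed

text \<open>The candidate is \<open>\<phi>\<close> composed with the canonical embedding
  \<open>ev\<close>; reflexivity makes \<open>ev\<close> surjective, so it suffices to compare on
  its image.\<close>

lemma reflexive_space_dual:
  assumes "reflexive_space TYPE('v::real_normed_vector)"
  shows "reflexive_space TYPE('v \<Rightarrow>\<^sub>L real)"
  unfolding reflexive_space_def
proof
  fix \<phi> :: "(('v \<Rightarrow>\<^sub>L real) \<Rightarrow>\<^sub>L real) \<Rightarrow>\<^sub>L real"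
  define ev :: "'v \<Rightarrow> (('v \<Rightarrow>\<^sub>L real) \<Rightarrow>\<^sub>L real)" where "ev x = Blinfun (\<lambda>p. blinfun_apply p x)" for x
  have ev: "blinfun_apply (ev x) p = blinfun_apply p x" for x p
    unfolding ev_def by (simp add: bounded_linear_Blinfun_apply blinfun.bounded_linear_left)
  have lin: "bounded_linear ev"
  proof (rule bounded_linear_intro[where K = 1])
    show "ev (x + y) = ev x + ev y" for x y
      by (rule blinfun_eqI) (simp add: ev blinfun.add_left blinfun.add_right)
    show "ev (r *\<^sub>R x) = r *\<^sub>R ev x" for r x
      by (rule blinfun_eqI) (simp add: ev blinfun.scaleR_left blinfun.scaleR_right)
    show "norm (ev x) \<le> norm x * 1" for x
    proof (rule norm_blinfun_bound)
      show "norm (blinfun_apply (ev x) p) \<le> norm x * 1 * norm p" for p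
        using norm_blinfun[of p x] by (simp add: ev mult.commute)
    qed simp
  qed
  define p where "p = \<phi> o\<^sub>L Blinfun ev"
  show "\<exists>p. \<forall>\<Phi>. blinfun_apply \<phi> \<Phi> = blinfun_apply \<Phi> p"
  proof (intro exI allI)
    fix \<Phi> :: "('v \<Rightarrow>\<^sub>L real) \<Rightarrow>\<^sub>L real"
    obtain x where "\<forall>p. blinfun_apply \<Phi> p = blinfun_apply p x"
      using assms unfolding reflexive_space_def by blast
    then have "\<Phi> = ev x" and *: "blinfun_apply \<Phi> p = blinfun_apply p x" by (auto intro: blinfun_eqI simp: ev)
    then show "blinfun_apply \<phi> \<Phi> = blinfun_apply \<Phi> p"
      by (simp only: *) (simp add: p_def bounded_linear_Blinfun_apply[OF lin])
  qed
qed

text \<open>Tychonoff's theorem stands in for an explicit diagonal extraction: the rows lie in a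
  compact product of intervals, and a countable product is first countable, so compactness is
  sequential.\<close>

lemma diagonal_convergent_subseq:
  fixes f :: "nat \<Rightarrow> nat \<Rightarrow> real"
  assumes "\<And>n i. \<bar>f n i\<bar> \<le> M i"
  obtains r g where "strict_mono r" "\<And>i. (\<lambda>n. f (r n) i) \<longlonglongrightarrow> g i"
proof -
  define K where "K = Pi\<^sub>E UNIV (\<lambda>i. {- M i .. M i})"
  have "compactin (product_topology (\<lambda>i::nat. euclidean :: real topology) UNIV) K"
    unfolding K_def compactin_PiE by simp
  then have "compact K" by (simp add: euclidean_product_topology)
  moreover have "\<forall>n. f n \<in> K" using assms by (auto simp: K_def abs_le_iff minus_le_iff)
  ultimately obtain g r where "strict_mono r" "(f \<circ> r) \<longlonglongrightarrow> g"
    using compact_imp_seq_compact[of K] unfolding seq_compact_def by metis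
  then have "(\<lambda>n. f (r n) i) \<longlonglongrightarrow> g i" for i
    using continuous_on_tendsto_compose[OF continuous_on_product_coordinates[of i], of "f \<circ> r" g sequentially]
    by (simp add: comp_def)
  with \<open>strict_mono r\<close> show ?thesis using that by blast
qed

text \<open>
  Every Hahn--Banach functional below the sublinear functional \<open>f \<mapsto> limsup (f (X n))\<close> on the dual
  is by reflexivity a point of the closed span of the sequence. After passing to a diagonal
  subsequence along a countable norming set there is only one such point, and this forces
  \<open>limsup = liminf\<close> for every \<open>f\<close>.
\<close>

theorem reflexive_weakly_convergent_subseq:
  fixes X :: "nat \<Rightarrow> 'v::real_normed_vector"
  assumes refl: "reflexive_space TYPE('v)" and bdd: "bounded (range X)"
  obtains x r where "strict_mono r" "weakly_tendsto (X \<circ> r) x"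
proof -
  obtain M where M: "M > 0" "\<And>n. norm (X n) \<le> M" using bdd by (auto simp: bounded_pos)
  define E where "E = rational_span (range X)"
  define V where "V = closure E"
  have XV: "X n \<in> V" for n
    using rational_span_superset[of "range X"] closure_subset[of E] unfolding E_def V_def by blast
  have sV: "subspace V" unfolding V_def E_def by (rule subspace_closure_rational_span)
  define e where "e = from_nat_into E"
  have rng: "range e = E"
  proof -
    have "E \<noteq> {}" using rational_span_superset[of "range X"] unfolding E_def by blast
    moreover have "countable E" unfolding E_def by (intro countable_rational_span) simp
    ultimately show ?thesis unfolding e_def by (rule range_from_nat_into)
  qed
  have "\<exists>p :: 'v \<Rightarrow>\<^sub>L real. norm p \<le> 1 \<and> blinfun_apply p (e i) = norm (e i)" for i
    using norming_functional by metis
  then obtain q :: "nat \<Rightarrow> 'v \<Rightarrow>\<^sub>L real" where q: "\<And>i. norm (q i) \<le> 1" "\<And>i. blinfun_apply (q i) (e i) = norm (e i)"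
    by metis
  have fle: "\<bar>blinfun_apply f (X n)\<bar> \<le> norm f * M" for f :: "'v \<Rightarrow>\<^sub>L real" and n
    using norm_blinfun[of f "X n"] mult_left_mono[OF M(2)[of n], of "norm f"] by simp
  obtain r g where r: "strict_mono r" and g: "\<And>i. (\<lambda>n. blinfun_apply (q i) (X (r n))) \<longlonglongrightarrow> g i"
    by (rule diagonal_convergent_subseq[of "\<lambda>n i. blinfun_apply (q i) (X n)" "\<lambda>i. norm (q i) * M", OF fle])
      (rule that)
  define Y where "Y = X \<circ> r"
  \<comment> \<open>Eventual upper bounds keep the limit superior inside the reals; boundedness of
    \<open>X\<close> makes \<open>U f\<close> nonempty and bounded below.\<close>
  define U where "U f = {c. \<forall>\<^sub>F n in sequentially. blinfun_apply f (Y n) \<le> c}" for f :: "'v \<Rightarrow>\<^sub>L real"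
  define S where "S f = (INF c\<in>U f. c)" for f
  have Une: "norm f * M \<in> U f" for f
    using fle[of f] by (auto simp: U_def Y_def abs_le_iff)
  have Ulow: "- (norm f * M) \<le> c" if c: "c \<in> U f" for c f
  proof -
    obtain n where "blinfun_apply f (Y n) \<le> c"
      using c eventually_happens'[OF sequentially_bot, of "\<lambda>n. blinfun_apply f (Y n) \<le> c"]
      by (auto simp: U_def)
    then show ?thesis using fle[of f "r n"] by (simp add: Y_def abs_le_iff)
  qed
  then have Ubdd: "bdd_below ((\<lambda>c. c) ` U f)" for f
    by (intro bdd_belowI2[of _ "- (norm f * M)"]) auto
  have Sle: "S f \<le> c" if "\<forall>\<^sub>F n in sequentially. blinfun_apply f (Y n) \<le> c" for f c
    unfolding S_def by (rule cINF_lower[OF Ubdd]) (use that in \<open>simp add: U_def\<close>)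
  have Sgr: "\<forall>\<^sub>F n in sequentially. blinfun_apply f (Y n) \<le> c" if less: "S f < c" for f c
  proof -
    obtain c' where "c' \<in> U f" "c' < c"
      using less Une[of f] cInf_lessD[of "U f" c] by (auto simp: S_def)
    then show ?thesis unfolding U_def by (auto elim!: eventually_mono)
  qed
  have sub: "sublinear S"
    unfolding sublinear_def
  proof (intro conjI allI impI)
    fix f h
    show "S (f + h) \<le> S f + S h"
      unfolding S_def[of f] S_def[of h]
    proof (rule le_INF_add_INF)
      fix s t assume "s \<in> U f" "t \<in> U h"
      then have "\<forall>\<^sub>F n in sequentially. blinfun_apply (f + h) (Y n) \<le> s + t"
        unfolding U_def mem_Collect_eq by eventually_elim (simp add: blinfun.add_left)
      then show "S (f + h) \<le> s + t" by (rule Sle)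
    qed (use Une in auto)
  next
    fix t :: real and f assume t: "0 < t"
    have "S (t *\<^sub>R f) / t \<le> S f"
      unfolding S_def[of f]
    proof (rule cINF_greatest)
      fix c assume "c \<in> U f"
      then have "\<forall>\<^sub>F n in sequentially. blinfun_apply (t *\<^sub>R f) (Y n) \<le> t * c"
        unfolding U_def mem_Collect_eq by eventually_elim (use t in \<open>simp add: blinfun.scaleR_left\<close>)
      from Sle[OF this] show "S (t *\<^sub>R f) / t \<le> c" using t by (simp add: field_simps)
    qed (use Une in auto)
    then show "S (t *\<^sub>R f) \<le> t * S f" using t by (simp add: field_simps)
  qed
  have pt: "\<exists>x. (\<forall>f. blinfun_apply f x \<le> S f) \<and> blinfun_apply f0 x = S f0" for f0
  proof -
    obtain l where l: "linear l" "\<And>f. l f \<le> S f" "l f0 = S f0"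
      using Hahn_Banach_sublinear[OF sub, of f0] by metis
    have "l f \<le> M" if "norm f \<le> 1" for f
    proof -
      have "norm f * M \<le> 1 * M" using that M(1) by (intro mult_right_mono) auto
      moreover have "S f \<le> norm f * M" using Une[of f] by (intro Sle) (simp add: U_def)
      ultimately show ?thesis using l(2)[of f] by simp
    qed
    then have bl: "bounded_linear l"
      using bounded_linear_if_bounded_above(1)[OF l(1) zero_less_one] by blast
    obtain x where "\<forall>f. blinfun_apply (Blinfun l) f = blinfun_apply f x"
      using refl unfolding reflexive_space_def by blast
    then have "\<And>f. l f = blinfun_apply f x" by (simp add: bounded_linear_Blinfun_apply[OF bl])
    then show ?thesis using l by metis
  qed
  have inV: "x \<in> V" if x: "\<And>f. blinfun_apply f x \<le> S f" for x
  proof (rule ccontr)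
    assume "x \<notin> V"
    then obtain p :: "'v \<Rightarrow>\<^sub>L real" and d where d: "d > 0" "\<And>z. z \<in> V \<Longrightarrow> blinfun_apply p x + d \<le> blinfun_apply p z"
    proof -
      have "closed V" "convex V" "V \<noteq> {}" using sV XV[of 0] by (auto simp: V_def subspace_imp_convex)
      from closed_convex_separation[OF this \<open>x \<notin> V\<close>] show ?thesis using that by metis
    qed
    have "S (- p) \<le> - (blinfun_apply p x + d)"
    proof (intro Sle always_eventually allI)
      show "blinfun_apply (- p) (Y n) \<le> - (blinfun_apply p x + d)" for n
        using d(2)[OF XV[of "r n"]] by (simp add: blinfun.minus_left Y_def)
    qed
    then show False using x[of "- p"] d(1) by (simp add: blinfun.minus_left)
  qed
  \<comment> \<open>Along \<open>q i\<close> the subsequence converges, so domination by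
    \<open>S\<close> at \<open>q i\<close> and at \<open>- q i\<close> pins the value.\<close>
  have qx: "blinfun_apply (q i) x = g i" if x: "\<And>f. blinfun_apply f x \<le> S f" for x i
  proof (rule antisym)
    show "blinfun_apply (q i) x \<le> g i"
    proof (rule field_le_epsilon)
      fix d :: real assume "d > 0"
      then have "\<forall>\<^sub>F n in sequentially. blinfun_apply (q i) (Y n) < g i + d"
        using g[of i] by (auto simp: Y_def intro: order_tendstoD)
      then have "S (q i) \<le> g i + d" by (intro Sle) (auto elim: eventually_mono)
      then show "blinfun_apply (q i) x \<le> g i + d" using x[of "q i"] by simp
    qed
    show "g i \<le> blinfun_apply (q i) x"
    proof (rule field_le_epsilon)
      fix d :: real assume "d > 0"
      then have "\<forall>\<^sub>F n in sequentially. g i - d < blinfun_apply (q i) (Y n)"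
        using g[of i] by (auto simp: Y_def intro: order_tendstoD)
      then have "S (- q i) \<le> - g i + d"
        by (intro Sle) (auto simp: blinfun.minus_left elim: eventually_mono)
      then show "g i \<le> blinfun_apply (q i) x + d" using x[of "- q i"] by (simp add: blinfun.minus_left)
    qed
  qed
  \<comment> \<open>The functional \<open>q i\<close> vanishes on the difference \<open>y\<close>
    but norms a nearby \<open>e i\<close>. So \<open>e i\<close> would be shorter than
    \<open>norm y / 2\<close>, which is impossible within distance \<open>norm y / 2\<close> of
    \<open>y\<close>.\<close>
  have uniq: "x = x'" if x: "\<And>f. blinfun_apply f x \<le> S f" and x': "\<And>f. blinfun_apply f x' \<le> S f" for x x'
  proof (rule ccontr)
    assume "x \<noteq> x'"
    define y where "y = x - x'"
    have y: "norm y > 0" "y \<in> V" using \<open>x \<noteq> x'\<close> inV[OF x] inV[OF x'] subspace_diff[OF sV] by (auto simp: y_def)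
    have "\<exists>z\<in>E. dist z y < norm y / 2"
      using closure_approachableD[of y E "norm y / 2"] y by (auto simp: V_def dist_commute)
    then obtain i where i: "dist (e i) y < norm y / 2" using rng by (metis imageE)
    have "blinfun_apply (q i) y = 0" by (simp add: y_def blinfun.diff_right qx[OF x] qx[OF x'])
    then have "norm (e i) = blinfun_apply (q i) (e i - y)" by (simp add: blinfun.diff_right q)
    also have "\<dots> \<le> norm (q i) * norm (e i - y)" using norm_blinfun[of "q i" "e i - y"] by simp
    also have "\<dots> \<le> norm (e i - y)" using mult_right_mono[OF q(1)[of i], of "norm (e i - y)"] by simp
    finally show False using i norm_triangle_ineq2[of y "e i"] by (simp add: dist_norm norm_minus_commute)
  qed
  obtain x where x: "\<And>f. blinfun_apply f x \<le> S f" using pt by blast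
  have fx: "S f = blinfun_apply f x" for f
    using pt[of f] uniq[OF x] by metis
  have "(\<lambda>n. blinfun_apply f (Y n)) \<longlonglongrightarrow> blinfun_apply f x" for f :: "'v \<Rightarrow>\<^sub>L real"
  proof (rule LIMSEQ_I)
    fix d :: real assume d: "d > 0"
    have "\<forall>\<^sub>F n in sequentially. blinfun_apply f (Y n) \<le> blinfun_apply f x + d/2"
      using d by (intro Sgr) (simp add: fx)
    moreover have "\<forall>\<^sub>F n in sequentially. blinfun_apply (- f) (Y n) \<le> - blinfun_apply f x + d/2"
      using d by (intro Sgr) (simp add: fx blinfun.minus_left)
    ultimately have "\<forall>\<^sub>F n in sequentially. norm (blinfun_apply f (Y n) - blinfun_apply f x) < d"
      by eventually_elim (use d in \<open>auto simp: blinfun.minus_left abs_less_iff\<close>)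
    then show "\<exists>no. \<forall>n\<ge>no. norm (blinfun_apply f (Y n) - blinfun_apply f x) < d"
      by (simp add: eventually_sequentially)
  qed
  then have "weakly_tendsto (X \<circ> r) x" by (simp add: weakly_tendsto_def Y_def)
  with r show ?thesis using that by blast
qed

section \<open>A finite Ky Fan inequality\<close>

text \<open>The dimension is a number that arises inside a proof, so points are functions on
  \<open>nat\<close> and continuity is sequential in the first \<open>n\<close> coordinates. Kuhn's
  lemma on grids of mesh \<open>1 / Suc k\<close> yields approximate fixed points, and compactness a
  limit.\<close>

theorem Brouwer_unit_cube_sequential:
  fixes F :: "(nat \<Rightarrow> real) \<Rightarrow> nat \<Rightarrow> real" and n :: nat
  defines "K \<equiv> {x. \<forall>i<n. 0 \<le> x i \<and> x i \<le> 1}"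
  assumes range: "\<And>x i. x \<in> K \<Longrightarrow> i < n \<Longrightarrow> 0 \<le> F x i \<and> F x i \<le> 1"
    and cont: "\<And>X x i. (\<And>m. X m \<in> K) \<Longrightarrow> x \<in> K \<Longrightarrow> (\<And>j. j < n \<Longrightarrow> (\<lambda>m. X m j) \<longlonglongrightarrow> x j) \<Longrightarrow>
      i < n \<Longrightarrow> (\<lambda>m. F (X m) i) \<longlonglongrightarrow> F x i"
  obtains x where "x \<in> K" "\<And>i. i < n \<Longrightarrow> F x i = x i"
proof -
  define pt where "pt p y = (\<lambda>i. real (y i) / real p)" for p :: nat and y :: "nat \<Rightarrow> nat"
  define nb where "nb q r \<longleftrightarrow> (\<forall>j<n. q j \<le> r j \<and> r j \<le> q j + 1)" for q r :: "nat \<Rightarrow> nat"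
  \<comment> \<open>Label 0 records that \<open>F\<close> does not lower the coordinate, label 1
    that it does not raise it. The upper face is forced to 1, which is consistent because
    \<open>F\<close> is at most 1.\<close>
  define label where "label p y i = (if pt p y i \<le> F (pt p y) i \<and> y i \<noteq> p then 0 else 1::nat)" for p y i
  have ptK: "pt p y \<in> K" if "\<And>i. i < n \<Longrightarrow> y i \<le> p" for p y
    unfolding K_def pt_def by (clarsimp simp: divide_le_eq_1) (use that in \<open>auto simp: le_eq_less_or_eq\<close>)
  have label0: "pt p y i \<le> F (pt p y) i" if "label p y i = 0" for p y i
    using that by (simp add: label_def split: if_splits)
  have label1: "F (pt p y) i \<le> pt p y i"
    if "label p y i \<noteq> 0" "\<And>i. i < n \<Longrightarrow> y i \<le> p" "i < n" "0 < p" for p y i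
    using that range[OF ptK[of y p] \<open>i < n\<close>] by (auto simp: label_def pt_def split: if_splits)
  have "\<exists>q. (\<forall>i<n. q i < p) \<and> (\<forall>i<n. \<exists>r s. nb q r \<and>
      nb q s \<and> label p r i = 0 \<and> label p s i \<noteq> 0)" if p: "0 < p" for p
  proof -
    have 0: "label p y i = 0" if "\<forall>i<n. y i \<le> p" "i < n" "y i = 0" for y i
      using that p range[OF ptK[of y p] \<open>i < n\<close>] by (auto simp: label_def pt_def)
    have l1: "\<forall>x. (\<forall>i<n. x i \<le> p) \<longrightarrow> (\<forall>i<n. label p x i = 0 \<or> label p x i = 1)" by (simp add: label_def)
    have l2: "\<forall>x. (\<forall>i<n. x i \<le> p) \<longrightarrow> (\<forall>i<n. x i = 0 \<longrightarrow> label p x i = 0)" using 0 by blast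
    have l3: "\<forall>x. (\<forall>i<n. x i \<le> p) \<longrightarrow> (\<forall>i<n. x i = p \<longrightarrow> label p x i = 1)" by (simp add: label_def)
    obtain q where q: "\<forall>i<n. q i < p" "\<forall>i<n. \<exists>r s. nb q r \<and>
      nb q s \<and> label p r i \<noteq> label p s i"
      by (rule kuhn_lemma[OF p l1 l2 l3]) (rule that, assumption, unfold nb_def, assumption)
    have "\<exists>r s. nb q r \<and>
      nb q s \<and> label p r i = 0 \<and> label p s i \<noteq> 0" if i: "i < n" for i
    proof -
      obtain r s where rs: "nb q r" "nb q s"
        "label p r i \<noteq> label p s i" using q(2) i by blast
      show ?thesis
      proof (cases "label p r i = 0")
        case True
        then show ?thesis using rs by (intro exI[of _ r] exI[of _ s]) simp
      next
        case False
        then have "label p s i = 0" using rs(3) by (auto simp: label_def split: if_splits)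
        then show ?thesis using rs False by (intro exI[of _ s] exI[of _ r]) simp
      qed
    qed
    then show ?thesis using q(1) by blast
  qed
  then have "\<forall>k. \<exists>q. (\<forall>i<n. q i < Suc k) \<and> (\<forall>i<n. \<exists>r s. nb q r \<and>
      nb q s \<and> label (Suc k) r i = 0 \<and> label (Suc k) s i \<noteq> 0)" by blast
  then obtain q where q: "\<And>k i. i < n \<Longrightarrow> q k i < Suc k" and
    qrs: "\<And>k i. i < n \<Longrightarrow> \<exists>r s. nb (q k) r \<and>
      nb (q k) s \<and> label (Suc k) r i = 0 \<and> label (Suc k) s i \<noteq> 0"
    unfolding choice_iff by blast
  \<comment> \<open>Coordinates from \<open>n\<close> on carry no bound, so they are set to 0 before
    compactness is applied over all of \<open>nat\<close>.\<close>
  have "\<bar>if i < n then pt (Suc k) (q k) i else 0\<bar> \<le> 1" for k i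
    using q[of i k] by (auto simp: pt_def divide_le_eq_1)
  then obtain \<rho> x where \<rho>: "strict_mono \<rho>" and
    x': "\<And>i. (\<lambda>k. if i < n then pt (Suc (\<rho> k)) (q (\<rho> k)) i else 0) \<longlonglongrightarrow> x i"
    by (rule diagonal_convergent_subseq[of "\<lambda>k i. if i < n then pt (Suc k) (q k) i else 0" "\<lambda>i. 1"]) (rule that)
  have x: "(\<lambda>k. pt (Suc (\<rho> k)) (q (\<rho> k)) i) \<longlonglongrightarrow> x i" if "i < n" for i
    using x'[of i] that by simp
  have xK: "x \<in> K"
  proof -
    have "pt (Suc (\<rho> k)) (q (\<rho> k)) \<in> K" for k using q by (intro ptK) (auto simp: less_imp_le)
    then show ?thesis
      unfolding K_def using LIMSEQ_le_const[OF x] LIMSEQ_le_const2[OF x] by (simp add: K_def)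
  qed
  have near: "(\<lambda>k. pt (Suc (\<rho> k)) (y k) i) \<longlonglongrightarrow> x i"
    if y: "\<And>k. q (\<rho> k) i \<le> y k i \<and> y k i \<le> q (\<rho> k) i + 1" and i: "i < n" for y i
  proof -
    have "(\<lambda>k. inverse (real (Suc (\<rho> k)))) \<longlonglongrightarrow> 0"
      using LIMSEQ_subseq_LIMSEQ[OF LIMSEQ_inverse_real_of_nat \<rho>] by (simp add: comp_def)
    from tendsto_add[OF x[OF i] this]
    have up: "(\<lambda>k. pt (Suc (\<rho> k)) (q (\<rho> k)) i + inverse (real (Suc (\<rho> k)))) \<longlonglongrightarrow> x i" by simp
    have "pt (Suc (\<rho> k)) (q (\<rho> k)) i \<le> pt (Suc (\<rho> k)) (y k) i" for k
      using y[of k] unfolding pt_def by (intro divide_right_mono) auto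
    moreover have "pt (Suc (\<rho> k)) (y k) i \<le> pt (Suc (\<rho> k)) (q (\<rho> k)) i + inverse (real (Suc (\<rho> k)))" for k
    proof -
      have "real (y k i) / real (Suc (\<rho> k)) \<le> (real (q (\<rho> k) i) + 1) / real (Suc (\<rho> k))"
        using y[of k] by (intro divide_right_mono) linarith+
      then show ?thesis unfolding pt_def by (simp only: add_divide_distrib inverse_eq_divide)
    qed
    ultimately show ?thesis
      by (intro tendsto_sandwich[OF _ _ x[OF i] up]) auto
  qed
  \<comment> \<open>The differently labelled vertices \<open>r\<close> and \<open>s\<close> of one
    small cell give opposite inequalities between \<open>F\<close> and the identity, and both
    converge to \<open>x\<close>.\<close>
  have "F x i = x i" if i: "i < n" for i
  proof -
    obtain r s where rs: "\<And>k. nb (q k) (r k)"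
      "\<And>k. nb (q k) (s k)"
      "\<And>k. label (Suc k) (r k) i = 0" "\<And>k. label (Suc k) (s k) i \<noteq> 0"
      using qrs[OF i] by metis
    have le: "r k j \<le> Suc k" "s k j \<le> Suc k" if "j < n" for k j
      using rs(1,2)[of k] q[of j k] that by (auto simp: nb_def dest!: spec[of _ j])
    define R where "R k = pt (Suc (\<rho> k)) (r (\<rho> k))" for k
    define T where "T k = pt (Suc (\<rho> k)) (s (\<rho> k))" for k
    have lim: "(\<lambda>k. R k j) \<longlonglongrightarrow> x j" "(\<lambda>k. T k j) \<longlonglongrightarrow> x j" if "j < n" for j
      unfolding R_def T_def using rs(1,2) that by (auto simp: nb_def intro!: near)
    have "R k \<in> K" "T k \<in> K" for k unfolding R_def T_def using le by (auto intro!: ptK)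
    then have "(\<lambda>k. F (R k) i) \<longlonglongrightarrow> F x i" "(\<lambda>k. F (T k) i) \<longlonglongrightarrow> F x i"
      by (auto intro!: cont[OF _ xK _ i] lim)
    moreover have "R k i \<le> F (R k) i" for k unfolding R_def by (rule label0) (rule rs)
    moreover have "F (T k) i \<le> T k i" for k
      unfolding T_def using rs(4) le i by (intro label1) auto
    ultimately show ?thesis
      using lim[OF i] by (intro antisym) (auto intro: LIMSEQ_le)
  qed
  with xK show ?thesis using that by blast
qed

text \<open>
  The map moves the barycentric coordinates towards the violated
  constraints; at a fixed point \<open>t\<close> with a violated constraint the sum in \<open>diag\<close> would be positive.
\<close>

theorem Ky_Fan_simplex:
  fixes G :: "(nat \<Rightarrow> real) \<Rightarrow> nat \<Rightarrow> real" and m :: nat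
  defines "\<Delta> \<equiv> {t. (\<forall>i<m. 0 \<le> t i) \<and> (\<Sum>i<m. t i) = 1}"
  assumes m: "0 < m"
    and cont: "\<And>X x i. (\<And>k. X k \<in> \<Delta>) \<Longrightarrow> x \<in> \<Delta> \<Longrightarrow> (\<And>j. j < m \<Longrightarrow> (\<lambda>k. X k j) \<longlonglongrightarrow> x j) \<Longrightarrow>
      i < m \<Longrightarrow> (\<lambda>k. G (X k) i) \<longlonglongrightarrow> G x i"
    and diag: "\<And>t. t \<in> \<Delta> \<Longrightarrow> (\<Sum>i<m. t i * G t i) \<le> 0"
  obtains t where "t \<in> \<Delta>" "\<And>i. i < m \<Longrightarrow> G t i \<le> 0"
proof -
  define S where "S t = (\<Sum>i<m. t i)" for t :: "nat \<Rightarrow> real"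
  \<comment> \<open>A retraction of the orthant onto the simplex that never divides by zero: a sum
    above 1 is divided out, a deficit below 1 is spread evenly. It makes the cube version of Brouwer
    applicable.\<close>
  define \<psi> where "\<psi> t i = t i / max 1 (S t) + max 0 (1 - S t) / real m" for t i
  define f where "f t i = max 0 (G (\<psi> t) i)" for t i
  define \<phi> where "\<phi> t i = (\<psi> t i + f t i) / (1 + (\<Sum>i<m. f t i))" for t i
  have \<psi>sum: "(\<Sum>i<m. \<psi> t i) = 1" for t
  proof -
    have "(\<Sum>i<m. \<psi> t i) = S t / max 1 (S t) + max 0 (1 - S t)"
      using m by (simp add: \<psi>_def sum.distrib S_def flip: sum_divide_distrib)
    then show ?thesis by (simp add: max_def)
  qed
  have \<psi>\<Delta>: "\<psi> t \<in> \<Delta>" if "\<forall>i<m. 0 \<le> t i" for t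
    using that \<psi>sum by (auto simp: \<Delta>_def \<psi>_def)
  have f0: "0 \<le> f t i" "0 \<le> (\<Sum>i<m. f t i)" for t i by (auto simp: f_def sum_nonneg)
  have \<phi>sum: "(\<Sum>i<m. \<phi> t i) = 1" for t
    using f0(2)[of t] by (simp add: \<phi>_def sum.distrib \<psi>sum flip: sum_divide_distrib)
  have \<phi>0: "0 \<le> \<phi> t i" if "\<forall>i<m. 0 \<le> t i" "i < m" for t i
    using \<psi>\<Delta>[OF that(1)] that(2) f0[of t] by (auto simp: \<phi>_def \<Delta>_def intro!: divide_nonneg_nonneg add_nonneg_nonneg)
  obtain t where t: "\<forall>i<m. 0 \<le> t i \<and> t i \<le> 1" and fp: "\<And>i. i < m \<Longrightarrow> \<phi> t i = t i"
  proof (rule Brouwer_unit_cube_sequential[of m \<phi>])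
    fix x i assume x: "x \<in> {x. \<forall>i<m. 0 \<le> x i \<and> x i \<le> (1::real)}" and i: "i < m"
    then have nn: "\<And>i. i < m \<Longrightarrow> 0 \<le> \<phi> x i" using \<phi>0[of x] by auto
    have "\<phi> x i \<le> (\<Sum>i<m. \<phi> x i)" using nn i by (intro member_le_sum) auto
    then show "0 \<le> \<phi> x i \<and> \<phi> x i \<le> 1" using nn[OF i] \<phi>sum[of x] by simp
  next
    fix X :: "nat \<Rightarrow> nat \<Rightarrow> real" and x i
    assume X: "\<And>k. X k \<in> {x. \<forall>i<m. 0 \<le> x i \<and> x i \<le> 1}" and x: "x \<in> {x. \<forall>i<m. 0 \<le> x i \<and> x i \<le> 1}"
      and lim: "\<And>j. j < m \<Longrightarrow> (\<lambda>k. X k j) \<longlonglongrightarrow> x j" and i: "i < m"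
    have S: "(\<lambda>k. S (X k)) \<longlonglongrightarrow> S x" unfolding S_def by (intro tendsto_sum lim) auto
    have \<psi>l: "(\<lambda>k. \<psi> (X k) j) \<longlonglongrightarrow> \<psi> x j" if "j < m" for j
      unfolding \<psi>_def using lim[OF that] S m by (intro tendsto_intros) auto
    have "(\<lambda>k. G (\<psi> (X k)) j) \<longlonglongrightarrow> G (\<psi> x) j" if "j < m" for j
      using X x \<psi>l that by (intro cont \<psi>\<Delta>) auto
    then have fl: "(\<lambda>k. f (X k) j) \<longlonglongrightarrow> f x j" if "j < m" for j
      unfolding f_def using that by (intro tendsto_intros) auto
    show "(\<lambda>k. \<phi> (X k) i) \<longlonglongrightarrow> \<phi> x i"
      unfolding \<phi>_def using f0(2)[of x] by (intro tendsto_intros \<psi>l fl i) auto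
  next
    fix x assume "x \<in> {x. \<forall>i<m. 0 \<le> x i \<and> x i \<le> (1::real)}" "\<And>i. i < m \<Longrightarrow> \<phi> x i = x i"
    then show ?thesis using that[of x] by simp
  qed
  define s where "s = \<psi> t"
  have s: "s \<in> \<Delta>" unfolding s_def using t by (intro \<psi>\<Delta>) auto
  \<comment> \<open>All values of \<open>\<phi>\<close> have coordinate sum 1, so the fixed point
    lies on the simplex, where \<open>\<psi>\<close> is the identity.\<close>
  have "S t = 1" using \<phi>sum[of t] fp by (simp add: S_def)
  then have st: "s i = t i" for i by (simp add: s_def \<psi>_def)
  define \<sigma> where "\<sigma> = (\<Sum>i<m. f t i)"
  have \<sigma>0: "0 \<le> \<sigma>" using f0 by (simp add: \<sigma>_def)
  have eq: "s i * \<sigma> = f t i" if "i < m" for i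
  proof -
    have "(s i + f t i) / (1 + \<sigma>) = s i" using fp[OF that] by (simp add: \<phi>_def \<sigma>_def st s_def[symmetric])
    then show ?thesis using \<sigma>0 by (simp add: field_simps)
  qed
  have "(\<Sum>i<m. f t i * f t i) = \<sigma> * (\<Sum>i<m. s i * G s i)"
    unfolding sum_distrib_left
  proof (rule sum.cong)
    fix i assume "i \<in> {..<m}"
    then have "\<sigma> * (s i * G s i) = f t i * G s i" using eq[of i] by (simp add: mult.assoc[symmetric] mult.commute)
    also have "\<dots> = f t i * f t i" by (simp add: f_def s_def max_def)
    finally show "f t i * f t i = \<sigma> * (s i * G s i)" by simp
  qed simp
  also have "\<dots> \<le> 0" using diag[OF s] \<sigma>0 by (simp add: mult_nonneg_nonpos)
  finally have "(\<Sum>i<m. f t i * f t i) = 0" by (intro antisym sum_nonneg) auto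
  then have "\<forall>i<m. f t i = 0" by (subst (asm) sum_nonneg_eq_0_iff) auto
  then have "G s i \<le> 0" if "i < m" for i
    using that max.cobounded2[of "G s i" 0] unfolding f_def s_def[symmetric] by metis
  with s show ?thesis using that by blast
qed

section \<open>Anti-selfdual Lagrangians\<close>

lemma convex_on_norm_square:
  fixes c :: "'v::real_normed_vector"
  shows "convex_on UNIV (\<lambda>x. (norm (x - c))\<^sup>2)"
  unfolding convex_on_def
proof (intro conjI ballI allI impI)
  fix x y and u v :: real assume uv: "0 \<le> u" "0 \<le> v" "u + v = 1"
  have "u *\<^sub>R x + v *\<^sub>R y - c = u *\<^sub>R (x - c) + v *\<^sub>R (y - c)"
    using uv(3) by (simp add: algebra_simps flip: scaleR_add_left)
  then have "norm (u *\<^sub>R x + v *\<^sub>R y - c) \<le> u * norm (x - c) + v * norm (y - c)"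
    using norm_triangle_ineq[of "u *\<^sub>R (x - c)" "v *\<^sub>R (y - c)"] uv by simp
  then have "(norm (u *\<^sub>R x + v *\<^sub>R y - c))\<^sup>2 \<le> (u * norm (x - c) + v * norm (y - c))\<^sup>2"
    by (intro power_mono) auto
  also have "\<dots> = u * (norm (x - c))\<^sup>2 + v * (norm (y - c))\<^sup>2 - u * v * (norm (x - c) - norm (y - c))\<^sup>2"
  proof -
    have v: "v = 1 - u" using uv by simp
    show ?thesis unfolding v by (simp add: power2_eq_square algebra_simps)
  qed
  also have "\<dots> \<le> u * (norm (x - c))\<^sup>2 + v * (norm (y - c))\<^sup>2" using uv by simp
  finally show "(norm (u *\<^sub>R x + v *\<^sub>R y - c))\<^sup>2 \<le> u * (norm (x - c))\<^sup>2 + v * (norm (y - c))\<^sup>2" .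
qed auto

lemma blinfun_le_norm: "blinfun_apply (p :: 'v::real_normed_vector \<Rightarrow>\<^sub>L real) x \<le> norm p * norm x"
  using norm_blinfun[of p x] by simp

section \<open>The Lagrangian as a real function, and the graph of
  \<open>bar_partial\<close>\<close>

locale asd_lagrangian =
  fixes L :: "'a::banach \<times> ('a \<Rightarrow>\<^sub>L real) \<Rightarrow> ereal" and J :: "'a \<Rightarrow> ('a \<Rightarrow>\<^sub>L real)"
  assumes refl: "reflexive_space TYPE('a)"
    and duality_map: "is_duality_map J"
    and asd: "antiselfdual_lagrangian L"
begin

lemma J_self: "blinfun_apply (J u) u = (norm u)\<^sup>2" and norm_J: "norm (J u) = norm u"
  using duality_map by (auto simp: is_duality_map_def)

lemma J_eqI: "blinfun_apply p u = (norm u)\<^sup>2 \<Longrightarrow> norm p = norm u \<Longrightarrow> p = J u"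
  using duality_map by (auto simp: is_duality_map_def)

lemma J_zero: "J 0 = 0"
  using norm_J[of 0] by simp

lemma J_monotone: "blinfun_apply (J u) (x - u) \<le> blinfun_apply (J x) (x - u)"
proof -
  have "blinfun_apply (J x) u \<le> norm x * norm u" "blinfun_apply (J u) x \<le> norm u * norm x"
    using blinfun_le_norm[of "J x" u] blinfun_le_norm[of "J u" x] by (auto simp: norm_J)
  moreover have "0 \<le> (norm x - norm u)\<^sup>2" by simp
  ultimately show ?thesis by (simp add: blinfun.diff_right J_self power2_eq_square algebra_simps)
qed

text \<open>Outside \<open>Dom L\<close> the value is the meaningless 0 that
  \<open>real_of_ereal\<close> assigns to infinity, so facts about \<open>lag\<close> come with
  membership in \<open>Dom L\<close>.\<close>

definition lag :: "'a \<times> ('a \<Rightarrow>\<^sub>L real) \<Rightarrow> real" where "lag z = real_of_ereal (L z)"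

lemma L_eq_lag: "z \<in> Dom L \<Longrightarrow> L z = ereal (lag z)"
proof -
  have "L z \<noteq> - \<infinity>" using asd unfolding antiselfdual_lagrangian_def by blast
  then show "z \<in> Dom L \<Longrightarrow> L z = ereal (lag z)" by (cases "L z") (auto simp: Dom_def lag_def)
qed

lemma L_le_ereal:
  assumes "L z \<le> ereal c"
  shows "z \<in> Dom L" "lag z \<le> c"
proof -
  show "z \<in> Dom L" using assms by (cases z) (auto simp: Dom_def le_less_trans[of _ "ereal c"])
  then show "lag z \<le> c" using assms L_eq_lag by simp
qed

lemma Dom_nonempty: "Dom L \<noteq> {}"
  using asd by (auto simp: antiselfdual_lagrangian_def Dom_def)

lemma convex_on_lag: "convex_on (Dom L) lag"
proof -
  have cv: "L (t *\<^sub>R u + (1 - t) *\<^sub>R v) \<le> ereal t * L u + ereal (1 - t) * L v" if "0 < t" "t < 1" for t u v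
    using asd that unfolding antiselfdual_lagrangian_def convex_fun_def by blast
  have main: "t *\<^sub>R u + (1 - t) *\<^sub>R v \<in> Dom L \<and> lag (t *\<^sub>R u + (1 - t) *\<^sub>R v) \<le> t * lag u + (1 - t) * lag v"
    if "u \<in> Dom L" "v \<in> Dom L" "0 < t" "t < 1" for t u v
  proof -
    have "L (t *\<^sub>R u + (1 - t) *\<^sub>R v) \<le> ereal (t * lag u + (1 - t) * lag v)"
      using cv[OF that(3,4), of u v] by (simp add: L_eq_lag[OF that(1)] L_eq_lag[OF that(2)])
    from L_le_ereal[OF this] show ?thesis by blast
  qed
  show ?thesis
  proof (rule convex_onI)
    show "convex (Dom L)"
      unfolding convex_alt
    proof (intro ballI allI impI)
      fix x y and t :: real assume "x \<in> Dom L" "y \<in> Dom L" "0 \<le> t \<and> t \<le> 1"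
      then show "(1 - t) *\<^sub>R x + t *\<^sub>R y \<in> Dom L"
        using main[of y x t] by (cases "t = 0"; cases "t = 1") (auto simp: add.commute)
    qed
    fix t :: real and x y assume "0 < t" "t < 1" "x \<in> Dom L" "y \<in> Dom L"
    then show "lag ((1 - t) *\<^sub>R x + t *\<^sub>R y) \<le> (1 - t) * lag x + t * lag y"
      using main[of y x t] by (simp add: add.commute)
  qed
qed

lemma convex_Dom: "convex (Dom L)"
  using convex_on_lag by (simp add: convex_on_def)

lemma Dom1_eq: "Dom1 L = fst ` Dom L"
  by (force simp: Dom1_def Dom_def)

lemma convex_Dom1: "convex (Dom1 L)"
  unfolding Dom1_eq by (intro convex_linear_image linear_fst convex_Dom)

lemma conjugate_eq: "conjugate L (- q, - y) = L (y, q)"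
  using asd by (simp add: antiselfdual_lagrangian_def)

lemma Fenchel_Young:
  assumes "(x, p) \<in> Dom L" "(y, q) \<in> Dom L"
  shows "- blinfun_apply q x - blinfun_apply p y - lag (x, p) \<le> lag (y, q)"
proof -
  have "ereal (blinfun_apply (- q) x + blinfun_apply p (- y)) - L (x, p) \<le> conjugate L (- q, - y)"
    unfolding conjugate_def prod.case by (rule SUP_upper2[of "(x, p)"]) auto
  then show ?thesis
    by (simp add: conjugate_eq L_eq_lag assms blinfun.minus_left blinfun.minus_right)
qed

text \<open>Anti-selfduality as a device for producing points of \<open>Dom L\<close>: bounding
  every term of the conjugate at \<open>(- q, - y)\<close> bounds \<open>L (y, q)\<close>,
  finiteness included.\<close>

lemma lag_le_by_duality:
  assumes "\<And>x p. (x, p) \<in> Dom L \<Longrightarrow> - blinfun_apply q x - blinfun_apply p y - lag (x, p) \<le> c"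
  shows "(y, q) \<in> Dom L" "lag (y, q) \<le> c"
proof -
  have "conjugate L (- q, - y) \<le> ereal c"
    unfolding conjugate_def prod.case
  proof (rule SUP_least, clarify)
    fix x p
    show "ereal (blinfun_apply (- q) x + blinfun_apply p (- y)) - L (x, p) \<le> ereal c"
    proof (cases "(x, p) \<in> Dom L")
      case True
      then show ?thesis
        using assms[OF True] by (simp add: L_eq_lag blinfun.minus_left blinfun.minus_right)
    next
      case False
      then have "L (x, p) = \<infinity>" by (auto simp: Dom_def)
      then show ?thesis by simp
    qed
  qed
  then have "L (y, q) \<le> ereal c" by (simp add: conjugate_eq)
  then show "(y, q) \<in> Dom L" "lag (y, q) \<le> c" by (rule L_le_ereal)+
qed

lemma lag_ge: "(y, q) \<in> Dom L \<Longrightarrow> - blinfun_apply q y \<le> lag (y, q)"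
  using Fenchel_Young[of y q y q] by simp

text \<open>An inequality suffices because \<open>lag_ge\<close> supplies the reverse one, so
  membership can be proved from upper bounds alone.\<close>

definition graph :: "('a \<times> ('a \<Rightarrow>\<^sub>L real)) set" where
  "graph = {(y, p). (y, - p) \<in> Dom L \<and> lag (y, - p) \<le> blinfun_apply p y}"

lemma graph_iff_bar_partial: "(y, p) \<in> graph \<longleftrightarrow> p \<in> bar_partial L y"
proof
  assume "(y, p) \<in> graph"
  then have "(y, - p) \<in> Dom L" "lag (y, - p) = blinfun_apply p y"
    using lag_ge[of y "- p"] by (auto simp: graph_def blinfun.minus_left)
  then show "p \<in> bar_partial L y" by (simp add: bar_partial_def L_eq_lag zero_ereal_def)
next
  assume "p \<in> bar_partial L y"
  then have "L (y, - p) = ereal (blinfun_apply p y)"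
    by (cases "L (y, - p)") (auto simp: bar_partial_def zero_ereal_def)
  then show "(y, p) \<in> graph" using L_le_ereal[of "(y, - p)"] by (auto simp: graph_def)
qed

lemma graph_monotone:
  assumes "(x, p) \<in> graph" "(y, q) \<in> graph"
  shows "0 \<le> blinfun_apply (p - q) (x - y)"
  using Fenchel_Young[of x "- p" y "- q"] assms
  by (auto simp: graph_def blinfun.diff_left blinfun.diff_right blinfun.minus_left)

text \<open>The bound is checked term by term in the conjugate, where each term is continuous in
  \<open>(y, p)\<close> and the limit passes through.\<close>

lemma graph_closed:
  assumes "\<And>n. (Y n, P n) \<in> graph" "Y \<longlonglongrightarrow> y" "P \<longlonglongrightarrow> p"
  shows "(y, p) \<in> graph"
proof -
  have "- blinfun_apply (- p) x - blinfun_apply r y - lag (x, r) \<le> blinfun_apply p y" if "(x, r) \<in> Dom L" for x r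
  proof (rule LIMSEQ_le)
    show "(\<lambda>n. - blinfun_apply (- P n) x - blinfun_apply r (Y n) - lag (x, r)) \<longlonglongrightarrow>
      - blinfun_apply (- p) x - blinfun_apply r y - lag (x, r)"
      by (intro tendsto_intros assms blinfun.tendsto)
    show "(\<lambda>n. blinfun_apply (P n) (Y n)) \<longlonglongrightarrow> blinfun_apply p y"
      by (intro blinfun.tendsto assms)
    have "- blinfun_apply (- P n) x - blinfun_apply r (Y n) - lag (x, r) \<le> blinfun_apply (P n) (Y n)" for n
      using Fenchel_Young[OF that, of "Y n" "- P n"] assms(1)[of n] by (auto simp: graph_def)
    then show "\<exists>N. \<forall>n\<ge>N. - blinfun_apply (- P n) x - blinfun_apply r (Y n) - lag (x, r) \<le> blinfun_apply (P n) (Y n)"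
      by blast
  qed
  from lag_le_by_duality[OF this] show ?thesis by (simp add: graph_def)
qed

text \<open>An inverse of the duality map at \<open>r\<close>: by reflexivity a norming functional
  on the dual is a point of the space, which is then scaled by \<open>norm r\<close>.\<close>

lemma dual_norming_point:
  obtains x :: 'a where "norm x \<le> norm r" "blinfun_apply r x = (norm r)\<^sup>2"
proof -
  obtain \<Phi> :: "('a \<Rightarrow>\<^sub>L real) \<Rightarrow>\<^sub>L real" where \<Phi>: "norm \<Phi> \<le> 1" "blinfun_apply \<Phi> r = norm r"
    by (rule norming_functional)
  obtain x where x: "\<And>p. blinfun_apply \<Phi> p = blinfun_apply p x"
    using refl unfolding reflexive_space_def by blast
  obtain p :: "'a \<Rightarrow>\<^sub>L real" where p: "norm p \<le> 1" "blinfun_apply p x = norm x"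
    by (rule norming_functional)
  have "norm x = blinfun_apply \<Phi> p" by (simp add: x p)
  also have "\<dots> \<le> norm \<Phi> * norm p" by (rule blinfun_le_norm)
  also have "\<dots> \<le> 1" using \<Phi>(1) p(1) by (simp add: mult_le_one)
  finally have "norm (norm r *\<^sub>R x) \<le> norm r" by (simp add: mult_left_le)
  moreover have "blinfun_apply r (norm r *\<^sub>R x) = (norm r)\<^sup>2"
    using \<Phi>(2) x[of r] by (simp add: blinfun.scaleR_right power2_eq_square)
  ultimately show ?thesis by (rule that)
qed

text \<open>
  Expanding \<open>-\<langle>q - b, x - a\<rangle> + \<langle>q, x\<rangle>\<close> leaves an affine function,
  which makes \<open>h\<close> below convex; Fenchel duality and anti-selfduality then turn \<open>0 \<le> lag + h\<close>
  into a point where \<open>lag + h \<le> 0\<close>.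
\<close>

theorem graph_resolvent: "\<exists>y. (y, - b - J (y - a)) \<in> graph"
proof -
  define h :: "'a \<times> ('a \<Rightarrow>\<^sub>L real) \<Rightarrow> real" where "h = (\<lambda>w. blinfun_apply (snd w) a + blinfun_apply b (fst w) - blinfun_apply b a
    + (norm (fst w - a))\<^sup>2 / 2 + (norm (snd w - b))\<^sup>2 / 2)"
  have "convex_on UNIV h"
    unfolding convex_on_def
  proof (intro conjI ballI allI impI)
    fix x y :: "'a \<times> ('a \<Rightarrow>\<^sub>L real)" and u v :: real assume uv: "0 \<le> u" "0 \<le> v" "u + v = 1"
    have 1: "(norm (u *\<^sub>R fst x + v *\<^sub>R fst y - a))\<^sup>2 \<le> u * (norm (fst x - a))\<^sup>2 + v * (norm (fst y - a))\<^sup>2"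
      using convex_on_norm_square[of a] uv unfolding convex_on_def by blast
    have 2: "(norm (u *\<^sub>R snd x + v *\<^sub>R snd y - b))\<^sup>2 \<le> u * (norm (snd x - b))\<^sup>2 + v * (norm (snd y - b))\<^sup>2"
      using convex_on_norm_square[of b] uv unfolding convex_on_def by blast
    have v: "v = 1 - u" using uv by simp
    have "blinfun_apply b a = u * blinfun_apply b a + v * blinfun_apply b a" by (simp add: v algebra_simps)
    then show "h (u *\<^sub>R x + v *\<^sub>R y) \<le> u * h x + v * h y"
      using 1 2 by (simp add: h_def blinfun.add_left blinfun.add_right blinfun.scaleR_left blinfun.scaleR_right
          distrib_left right_diff_distrib)
  qed auto
  moreover have "0 \<le> lag z + h z" if z: "z \<in> Dom L" for z
  proof -
    obtain x q where zz: "z = (x, q)" by (cases z)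
    have "blinfun_apply (q - b) (x - a) \<le> norm (q - b) * norm (x - a)" by (rule blinfun_le_norm)
    moreover have "0 \<le> (norm (q - b) - norm (x - a))\<^sup>2" by simp
    ultimately show ?thesis
      using lag_ge[of x q] z
      by (simp add: zz h_def blinfun.diff_left blinfun.diff_right power2_eq_square algebra_simps)
  qed
  ultimately obtain l where l: "linear l" and lle: "\<And>z w. z \<in> Dom L \<Longrightarrow> l (w - z) \<le> lag z + h w - 0"
    using convex_sandwich_linear[OF convex_on_lag Dom_nonempty, of h 0] by metis
  obtain z0 where z0: "z0 \<in> Dom L" using Dom_nonempty by auto
  define R where "R = norm z0 + 1"
  have "l x \<le> lag z0 + (R * norm a + norm b * R + norm b * norm a + (R + norm a)\<^sup>2 / 2 + (R + norm b)\<^sup>2 / 2)"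
    if x: "norm x \<le> 1" for x
  proof -
    define w where "w = x + z0"
    have "norm w \<le> R" using norm_triangle_ineq[of x z0] x by (simp add: R_def w_def)
    then have w: "norm (fst w) \<le> R" "norm (snd w) \<le> R"
      using norm_fst_le[of "fst w" "snd w"] norm_snd_le[of "snd w" "fst w"] by auto
    have "blinfun_apply (snd w) a \<le> R * norm a"
      using blinfun_le_norm[of "snd w" a] mult_right_mono[OF w(2), of "norm a"] by simp
    moreover have "blinfun_apply b (fst w) \<le> norm b * R"
      using blinfun_le_norm[of b "fst w"] mult_left_mono[OF w(1), of "norm b"] by simp
    moreover have "- blinfun_apply b a \<le> norm b * norm a"
      using blinfun_le_norm[of "- b" a] by (simp add: blinfun.minus_left)
    moreover have "(norm (fst w - a))\<^sup>2 \<le> (R + norm a)\<^sup>2"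
      using norm_triangle_ineq4[of "fst w" a] w by (intro power_mono) auto
    moreover have "(norm (snd w - b))\<^sup>2 \<le> (R + norm b)\<^sup>2"
      using norm_triangle_ineq4[of "snd w" b] w by (intro power_mono) auto
    moreover have "l x \<le> lag z0 + h w" using lle[OF z0, of w] by (simp add: w_def)
    ultimately show ?thesis unfolding h_def by linarith
  qed
  from bounded_linear_if_bounded_above(1)[OF l zero_less_one this]
  have bl: "bounded_linear l" .
  define q where "q = Blinfun (\<lambda>x. l (x, 0))"
  have q: "blinfun_apply q x = l (x, 0)" for x
    unfolding q_def
    by (subst bounded_linear_Blinfun_apply)
      (auto intro!: bounded_linear_compose[OF bl] bounded_linear_Pair bounded_linear_ident bounded_linear_zero)
  define \<Psi> where "\<Psi> = Blinfun (\<lambda>p. l (0, p))"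
  have \<Psi>: "blinfun_apply \<Psi> p = l (0, p)" for p
    unfolding \<Psi>_def
    by (subst bounded_linear_Blinfun_apply)
      (auto intro!: bounded_linear_compose[OF bl] bounded_linear_Pair bounded_linear_ident bounded_linear_zero)
  obtain y where y: "\<And>p. blinfun_apply \<Psi> p = blinfun_apply p y"
    using refl unfolding reflexive_space_def by blast
  have l_eq: "l (x, p) = blinfun_apply q x + blinfun_apply p y" for x p
    using linear_add[OF l, of "(x, 0)" "(0, p)"] by (simp add: q y[symmetric] \<Psi>)
  \<comment> \<open>The point \<open>(a + \<xi>, b + \<eta>)\<close> maximizes \<open>l - h\<close>:
    stationarity asks for \<open>J \<xi> = q - b\<close> and
    \<open>\<eta> = J (y - a)\<close>.\<close>
  obtain \<xi> where \<xi>: "norm \<xi> \<le> norm (q - b)" "blinfun_apply (q - b) \<xi> = (norm (q - b))\<^sup>2"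
    by (rule dual_norming_point)
  define \<eta> where "\<eta> = J (y - a)"
  define s t where "s = norm (y - a)" and "t = norm (q - b)"
  have \<eta>: "norm \<eta> = s" "blinfun_apply \<eta> (y - a) = s\<^sup>2"
    using J_self[of "y - a"] norm_J[of "y - a"] by (simp_all add: \<eta>_def s_def)
  have "- blinfun_apply q x - blinfun_apply p y - lag (x, p) \<le>
      h (a + \<xi>, b + \<eta>) - blinfun_apply q (a + \<xi>) - blinfun_apply (b + \<eta>) y" if "(x, p) \<in> Dom L" for x p
  proof -
    have "l (a + \<xi>, b + \<eta>) - l (x, p) \<le> lag (x, p) + h (a + \<xi>, b + \<eta>)"
      using lle[OF that, of "(a + \<xi>, b + \<eta>)"] linear_diff[OF l, of "(a + \<xi>, b + \<eta>)" "(x, p)"] by simp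
    then show ?thesis by (simp add: l_eq)
  qed
  note yq = lag_le_by_duality[OF this]
  have "(norm \<xi>)\<^sup>2 \<le> t\<^sup>2" using \<xi>(1) by (intro power_mono) (auto simp: t_def)
  then have "h (a + \<xi>, b + \<eta>) \<le> blinfun_apply (b + \<eta>) a + blinfun_apply b \<xi> + t\<^sup>2 / 2 + s\<^sup>2 / 2"
    by (simp add: h_def \<eta> blinfun.add_right)
  with yq(2) have main: "lag (y, q) + blinfun_apply q y \<le> blinfun_apply (q - b) (y - a) - s\<^sup>2 / 2 - t\<^sup>2 / 2"
    using \<xi>(2) \<eta>(2) by (simp add: t_def blinfun.add_left blinfun.add_right blinfun.diff_left blinfun.diff_right)
  have ge: "0 \<le> lag (y, q) + blinfun_apply q y" using lag_ge[OF yq(1)] by simp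
  \<comment> \<open>Together with \<open>main\<close> and \<open>ge\<close> this leaves
    \<open>s^2 / 2 + t^2 / 2 <= t * s\<close>. Equality therefore holds throughout, and uniqueness
    of the duality map identifies \<open>q - b\<close>.\<close>
  have "blinfun_apply (q - b) (y - a) \<le> t * s" unfolding s_def t_def by (rule blinfun_le_norm)
  then have "(s - t)\<^sup>2 \<le> 0" using main ge by (simp add: power2_eq_square algebra_simps)
  then have st: "s = t" by simp
  have "blinfun_apply (q - b) (y - a) = s\<^sup>2"
    using main ge \<open>blinfun_apply (q - b) (y - a) \<le> t * s\<close> by (simp add: st power2_eq_square)
  then have "q - b = J (y - a)" using st by (intro J_eqI) (auto simp: s_def t_def)
  then have "q = b + J (y - a)" by (simp add: algebra_simps)
  moreover have "(y, - q) \<in> graph"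
    using yq(1) main \<open>blinfun_apply (q - b) (y - a) = s\<^sup>2\<close> by (simp add: graph_def st blinfun.minus_left)
  ultimately show ?thesis by (intro exI[of _ y]) simp
qed

end

section \<open>Pseudo-regular perturbations\<close>

lemma joint_weak_subseq:
  fixes X :: "nat \<Rightarrow> 'v::real_normed_vector" and P :: "nat \<Rightarrow> 'w::real_normed_vector" and c :: "nat \<Rightarrow> real"
  assumes "reflexive_space TYPE('v)" "reflexive_space TYPE('w)"
    and bd: "bounded (range X)" "bounded (range P)" "bounded (range c)"
  obtains r x p \<gamma> where "strict_mono r" "weakly_tendsto (\<lambda>n. X (r n)) x"
    "weakly_tendsto (\<lambda>n. P (r n)) p" "(\<lambda>n. c (r n)) \<longlonglongrightarrow> \<gamma>"
proof -
  obtain r1 x where r1: "strict_mono r1" "weakly_tendsto (X \<circ> r1) x"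
    using reflexive_weakly_convergent_subseq[OF assms(1) bd(1)] by metis
  have "bounded (range (P \<circ> r1))" using bd(2) by (rule bounded_subset) auto
  then obtain r2 p where r2: "strict_mono r2" "weakly_tendsto (P \<circ> r1 \<circ> r2) p"
    using reflexive_weakly_convergent_subseq[OF assms(2)] by metis
  have "bounded (range (c \<circ> r1 \<circ> r2))" using bd(3) by (rule bounded_subset) auto
  then obtain \<gamma> r3 where r3: "strict_mono r3" "(c \<circ> r1 \<circ> r2 \<circ> r3) \<longlonglongrightarrow> \<gamma>"
    using bounded_imp_convergent_subsequence by metis
  show ?thesis
  proof (rule that[of "r1 \<circ> r2 \<circ> r3"])
    show "strict_mono (r1 \<circ> r2 \<circ> r3)" using r1 r2 r3 by (simp add: strict_mono_o)
    show "weakly_tendsto (\<lambda>n. X ((r1 \<circ> r2 \<circ> r3) n)) x"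
      using weakly_tendsto_subseq[OF r1(2) strict_mono_o[OF r2(1) r3(1)]] by (simp add: comp_def)
    show "weakly_tendsto (\<lambda>n. P ((r1 \<circ> r2 \<circ> r3) n)) p"
      using weakly_tendsto_subseq[OF r2(2) r3(1)] by (simp add: comp_def)
    show "(\<lambda>n. c ((r1 \<circ> r2 \<circ> r3) n)) \<longlonglongrightarrow> \<gamma>" using r3(2) by (simp add: comp_def)
  qed
qed

lemma weakly_tendsto_dualD:
  fixes P :: "nat \<Rightarrow> 'v::real_normed_vector \<Rightarrow>\<^sub>L real"
  assumes "weakly_tendsto P p"
  shows "(\<lambda>n. blinfun_apply (P n) x) \<longlonglongrightarrow> blinfun_apply p x"
proof -
  have "blinfun_apply (Blinfun (\<lambda>p :: 'v \<Rightarrow>\<^sub>L real. blinfun_apply p x)) q = blinfun_apply q x" for q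
    by (simp add: bounded_linear_Blinfun_apply blinfun.bounded_linear_left)
  then show ?thesis
    using assms[unfolded weakly_tendsto_def, rule_format, of "Blinfun (\<lambda>p. blinfun_apply p x)"] by simp
qed

lemma tendsto_imp_weakly_tendsto: "X \<longlonglongrightarrow> x \<Longrightarrow> weakly_tendsto X x"
  unfolding weakly_tendsto_def by (auto intro: blinfun.tendsto)

lemma bounded_range_blinfun_apply:
  fixes P :: "nat \<Rightarrow> 'v::real_normed_vector \<Rightarrow>\<^sub>L real"
  assumes "bounded (range P)" "bounded (range X)"
  shows "bounded (range (\<lambda>n. blinfun_apply (P n) (X n)))"
proof -
  obtain A B where A: "\<And>n. norm (P n) \<le> A" "A > 0" and B: "\<And>n. norm (X n) \<le> B"
    using assms by (auto simp: bounded_pos)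
  have "norm (blinfun_apply (P n) (X n)) \<le> A * B" for n
    using norm_blinfun[of "P n" "X n"] mult_mono[OF A(1) B, of n n] A(2) by simp
  then show ?thesis by (auto simp: bounded_iff)
qed

text \<open>The functions \<open>\<theta>\<close> and \<open>g\<close> are later a cut-off and a
  growing weight. Keeping them abstract isolates what the limit arguments rely on: continuous
  dependence on the norm, with \<open>\<theta>\<close> allowed to vanish and \<open>g\<close>
  not.\<close>

locale pseudo_regular_perturbation = asd_lagrangian L J
  for L :: "'a::banach \<times> ('a \<Rightarrow>\<^sub>L real) \<Rightarrow> ereal" and J +
  fixes D :: "'a set" and \<Lambda> :: "'a \<Rightarrow> ('a \<Rightarrow>\<^sub>L real)" and \<theta> g :: "real \<Rightarrow> real"
  assumes zero_Dom: "(0, 0) \<in> Dom L"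
    and closed_Dom1: "closed (Dom1 L)"
    and \<Lambda>_bounded: "bounded_map D \<Lambda>"
    and \<Lambda>_regular: "pseudo_regular D \<Lambda>"
    and Dom1_subset: "Dom1 L \<subseteq> D"
    and cont_\<theta>: "continuous_on UNIV \<theta>" and \<theta>_nonneg: "\<And>r. 0 \<le> \<theta> r"
    and cont_g: "continuous_on UNIV g" and g_pos: "\<And>r. 0 < g r"
begin

definition T :: "'a \<Rightarrow> ('a \<Rightarrow>\<^sub>L real)" where
  "T x = \<theta> (norm x) *\<^sub>R \<Lambda> x + g (norm x) *\<^sub>R J x"

lemma \<Lambda>_bounded_seq:
  "(\<And>n. X n \<in> D) \<Longrightarrow> bounded (range X) \<Longrightarrow> bounded (range (\<lambda>n. \<Lambda> (X n)))"
  using \<Lambda>_bounded[unfolded bounded_map_def, rule_format, of "range X"] by (simp add: image_image image_subset_iff)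

lemma J_bounded_seq: "bounded (range X) \<Longrightarrow> bounded (range (\<lambda>n. J (X n)))"
  by (auto simp: bounded_iff norm_J)

lemma T_bounded_seq:
  fixes X :: "nat \<Rightarrow> 'a"
  assumes "\<And>n. X n \<in> D" "bounded (range X)"
  shows "bounded (range (\<lambda>n. T (X n)))"
proof -
  have bdn: "bounded (range (\<lambda>n. h (norm (X n)) *\<^sub>R P n))"
    if P: "bounded (range P)" and h: "continuous_on UNIV h" for h :: "real \<Rightarrow> real" and P :: "nat \<Rightarrow> 'a \<Rightarrow>\<^sub>L real"
  proof -
    obtain R where R: "\<And>n. norm (X n) \<le> R" using assms(2) by (auto simp: bounded_iff)
    obtain A where A: "\<And>n. norm (P n) \<le> A" using P by (auto simp: bounded_iff)
    have "compact (h ` {0..R})"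
      using h continuous_on_subset by (intro compact_continuous_image) auto
    from compact_imp_bounded[OF this]
    obtain H where H: "\<forall>r\<in>{0..R}. norm (h r) \<le> H" by (auto simp: bounded_iff)
    have "norm (h (norm (X n)) *\<^sub>R P n) \<le> H * A" for n
      using bspec[OF H, of "norm (X n)"] R[of n] A[of n] by (auto intro: mult_mono)
    then show ?thesis by (auto simp: bounded_iff)
  qed
  show ?thesis
    unfolding T_def
    using bounded_plus_comp[OF bdn[OF \<Lambda>_bounded_seq[OF assms] cont_\<theta>] bdn[OF J_bounded_seq[OF assms(2)] cont_g]]
    by simp
qed

text \<open>
  The duality map part of \<open>T\<close> is monotone up to a weakly null term and \<open>g\<close> is positive, so the
  hypothesis \<open>c \<le> \<langle>z, u\<rangle>\<close> is inherited by \<open>\<Lambda>\<close> alone wherever \<open>\<theta>\<close> does not vanish in the limit;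
  pseudo-regularity then forces equality, hence convergence of the norms.
\<close>

lemma pseudo_limit:
  assumes X: "\<And>n. X n \<in> D" "u \<in> D" "weakly_tendsto X u" "bounded (range X)"
    and z: "weakly_tendsto (\<lambda>n. T (X n)) z"
    and c: "(\<lambda>n. blinfun_apply (T (X n)) (X n)) \<longlonglongrightarrow> c" "c \<le> blinfun_apply z u"
  shows "z = T u" "c = blinfun_apply z u"
proof -
  have dual: "reflexive_space TYPE('a \<Rightarrow>\<^sub>L real)" by (rule reflexive_space_dual[OF refl])
  \<comment> \<open>A weak limit of \<open>T (X n)\<close> says nothing about its summands, so a
    subsequence is taken along which \<open>\<Lambda>\<close>, \<open>J\<close> and the norms
    converge separately. The claims concern only \<open>u\<close>, \<open>z\<close> and
    \<open>c\<close>, which a subsequence keeps.\<close>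
  have "bounded (range (\<lambda>n. norm (X n)))" using X(4) by (auto simp: bounded_iff)
  then obtain \<rho> w j r where \<rho>: "strict_mono \<rho>" and w: "weakly_tendsto (\<lambda>n. \<Lambda> (X (\<rho> n))) w"
    and j: "weakly_tendsto (\<lambda>n. J (X (\<rho> n))) j" and r: "(\<lambda>n. norm (X (\<rho> n))) \<longlonglongrightarrow> r"
    by (rule joint_weak_subseq[OF dual dual \<Lambda>_bounded_seq[OF X(1,4)] J_bounded_seq[OF X(4)]]) (rule that)
  define Y where "Y = (\<lambda>n. X (\<rho> n))"
  have Y: "\<And>n. Y n \<in> D" "weakly_tendsto Y u" "bounded (range Y)"
    using X(1) weakly_tendsto_subseq[OF X(3) \<rho>] bounded_subset[OF X(4), of "range Y"]
    by (auto simp: Y_def comp_def)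
  have zY: "weakly_tendsto (\<lambda>n. T (Y n)) z"
    using weakly_tendsto_subseq[OF z \<rho>] by (simp add: Y_def comp_def)
  have cY: "(\<lambda>n. blinfun_apply (T (Y n)) (Y n)) \<longlonglongrightarrow> c"
    using LIMSEQ_subseq_LIMSEQ[OF c(1) \<rho>] by (simp add: Y_def comp_def)
  have rY: "(\<lambda>n. norm (Y n)) \<longlonglongrightarrow> r" using r by (simp add: Y_def)
  have \<theta>Y: "(\<lambda>n. \<theta> (norm (Y n))) \<longlonglongrightarrow> \<theta> r" and gY: "(\<lambda>n. g (norm (Y n))) \<longlonglongrightarrow> g r"
    using continuous_on_tendsto_compose[OF cont_\<theta> rY] continuous_on_tendsto_compose[OF cont_g rY] by auto
  have wD: "(\<lambda>n. blinfun_apply (\<Lambda> (Y n)) x) \<longlonglongrightarrow> blinfun_apply w x" for x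
    using weakly_tendsto_dualD[OF w] by (simp add: Y_def)
  have jD: "(\<lambda>n. blinfun_apply (J (Y n)) x) \<longlonglongrightarrow> blinfun_apply j x" for x
    using weakly_tendsto_dualD[OF j] by (simp add: Y_def)
  have zD: "(\<lambda>n. blinfun_apply (T (Y n)) x) \<longlonglongrightarrow> blinfun_apply z x" for x
    by (rule weakly_tendsto_dualD[OF zY])
  have z_eq: "z = \<theta> r *\<^sub>R w + g r *\<^sub>R j"
  proof (rule blinfun_eqI)
    fix x
    have "(\<lambda>n. blinfun_apply (T (Y n)) x) \<longlonglongrightarrow> \<theta> r * blinfun_apply w x + g r * blinfun_apply j x"
      unfolding T_def by (simp add: blinfun.add_left blinfun.scaleR_left) (intro tendsto_intros \<theta>Y gY wD jD)
    from LIMSEQ_unique[OF zD this]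
    show "blinfun_apply z x = blinfun_apply (\<theta> r *\<^sub>R w + g r *\<^sub>R j) x"
      by (simp add: blinfun.add_left blinfun.scaleR_left)
  qed
  have JY: "(\<lambda>n. blinfun_apply (J (Y n)) (Y n - u)) \<longlonglongrightarrow> r\<^sup>2 - blinfun_apply j u"
    unfolding blinfun.diff_right J_self by (intro tendsto_intros rY jD)
  have JY0: "0 \<le> r\<^sup>2 - blinfun_apply j u"
  proof (rule LIMSEQ_le[OF _ JY])
    have "(\<lambda>n. blinfun_apply (J u) (Y n)) \<longlonglongrightarrow> blinfun_apply (J u) u"
      using Y(2) by (simp add: weakly_tendsto_def)
    then show "(\<lambda>n. blinfun_apply (J u) (Y n - u)) \<longlonglongrightarrow> 0"
      by (simp add: blinfun.diff_right LIM_zero)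
  qed (use J_monotone in blast)
  have TY: "(\<lambda>n. blinfun_apply (T (Y n)) (Y n - u)) \<longlonglongrightarrow> c - blinfun_apply z u"
    unfolding blinfun.diff_right by (intro tendsto_intros cY zD)
  \<comment> \<open>The limit of the weighted \<open>\<Lambda>\<close> pairing, nonpositive by the
    hypothesis on \<open>c\<close>. It vanishes by boundedness of \<open>\<Lambda>\<close> if
    \<open>\<theta> r = 0\<close>, and otherwise by the liminf part of pseudo-regularity.\<close>
  define e where "e = c - blinfun_apply z u - g r * (r\<^sup>2 - blinfun_apply j u)"
  have "(\<lambda>n. blinfun_apply (T (Y n)) (Y n - u) - g (norm (Y n)) * blinfun_apply (J (Y n)) (Y n - u)) \<longlonglongrightarrow> e"
    unfolding e_def by (intro tendsto_intros TY gY JY)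
  then have eY: "(\<lambda>n. \<theta> (norm (Y n)) * blinfun_apply (\<Lambda> (Y n)) (Y n - u)) \<longlonglongrightarrow> e"
    by (simp add: T_def blinfun.add_left blinfun.scaleR_left)
  have gJ0: "0 \<le> g r * (r\<^sup>2 - blinfun_apply j u)" using JY0 g_pos[of r] by simp
  have e0: "e \<le> 0" using gJ0 c(2) by (simp add: e_def)
  have key: "e = 0 \<and> (\<theta> r = 0 \<or> w = \<Lambda> u)"
  proof (cases "\<theta> r = 0")
    case True
    have "bounded (range (\<lambda>n. Y n - u))"
      using bounded_translation[OF Y(3), of "- u"] by (simp add: image_image)
    from bounded_range_blinfun_apply[OF \<Lambda>_bounded_seq[OF Y(1,3)] this]
    obtain B where B: "\<And>n. \<bar>blinfun_apply (\<Lambda> (Y n)) (Y n - u)\<bar> \<le> B" by (auto simp: bounded_iff)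
    have "(\<lambda>n. \<theta> (norm (Y n)) * blinfun_apply (\<Lambda> (Y n)) (Y n - u)) \<longlonglongrightarrow> 0"
    proof (rule tendsto_0_le[of "\<lambda>n. \<theta> (norm (Y n))" _ _ B])
      show "(\<lambda>n. \<theta> (norm (Y n))) \<longlonglongrightarrow> 0" using \<theta>Y True by simp
      show "\<forall>\<^sub>F n in sequentially. norm (\<theta> (norm (Y n)) * blinfun_apply (\<Lambda> (Y n)) (Y n - u)) \<le> norm (\<theta> (norm (Y n))) * B"
        by (rule always_eventually) (auto simp: abs_mult intro!: mult_left_mono B)
    qed
    then have "e = 0" using LIMSEQ_unique[OF eY] by simp
    with True show ?thesis by simp
  next
    case False
    then have \<theta>r: "\<theta> r > 0" using \<theta>_nonneg[of r] by simp
    have lim: "(\<lambda>n. blinfun_apply (\<Lambda> (Y n)) (Y n - u)) \<longlonglongrightarrow> e / \<theta> r"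
    proof (rule Lim_transform_eventually)
      show "(\<lambda>n. \<theta> (norm (Y n)) * blinfun_apply (\<Lambda> (Y n)) (Y n - u) / \<theta> (norm (Y n))) \<longlonglongrightarrow> e / \<theta> r"
        by (intro tendsto_divide eY \<theta>Y False)
      have "\<forall>\<^sub>F n in sequentially. 0 < \<theta> (norm (Y n))" using \<theta>Y \<theta>r by (rule order_tendstoD)
      then show "\<forall>\<^sub>F n in sequentially. \<theta> (norm (Y n)) * blinfun_apply (\<Lambda> (Y n)) (Y n - u) / \<theta> (norm (Y n))
          = blinfun_apply (\<Lambda> (Y n)) (Y n - u)"
        by eventually_elim simp
    qed
    have "limsup (\<lambda>n. ereal (blinfun_apply (\<Lambda> (Y n)) (Y n - u))) = ereal (e / \<theta> r)"
      using lim by (intro lim_imp_Limsup) auto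
    also have "\<dots> \<le> 0" using e0 \<theta>r by (simp add: divide_nonpos_pos)
    finally have "liminf (\<lambda>n. ereal (blinfun_apply (\<Lambda> (Y n)) (Y n))) \<ge> ereal (blinfun_apply (\<Lambda> u) u)"
      and \<Lambda>Y: "weakly_tendsto (\<lambda>n. \<Lambda> (Y n)) (\<Lambda> u)"
      using \<Lambda>_regular Y X(2) unfolding pseudo_regular_def by blast+
    have w_eq: "w = \<Lambda> u"
      by (rule blinfun_eqI) (rule LIMSEQ_unique[OF wD weakly_tendsto_dualD[OF \<Lambda>Y]])
    have "(\<lambda>n. blinfun_apply (\<Lambda> (Y n)) (Y n)) \<longlonglongrightarrow> e / \<theta> r + blinfun_apply w u"
      using tendsto_add[OF lim wD[of u]] by (simp add: blinfun.diff_right)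
    then have "liminf (\<lambda>n. ereal (blinfun_apply (\<Lambda> (Y n)) (Y n))) = ereal (e / \<theta> r + blinfun_apply w u)"
      by (intro lim_imp_Liminf) auto
    with \<open>liminf _ \<ge> _\<close> have "0 \<le> e / \<theta> r" by (simp add: w_eq)
    then have "0 \<le> e" using \<theta>r by (simp add: zero_le_divide_iff)
    with e0 w_eq show ?thesis by simp
  qed
  then show c_eq: "c = blinfun_apply z u" using gJ0 c(2) by (simp add: e_def)
  have "g r * (r\<^sup>2 - blinfun_apply j u) = 0"
    using conjunct1[OF key] gJ0 c(2) unfolding e_def by linarith
  \<comment> \<open>The norms of \<open>u\<close> and \<open>j\<close> are at most \<open>r\<close>
    as weak limits, while their pairing is \<open>r^2\<close>. Hence both norms equal
    \<open>r\<close>, and \<open>j\<close> has the properties that define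
    \<open>J u\<close>.\<close>
  then have ju: "blinfun_apply j u = r\<^sup>2" using g_pos[of r] by simp
  have r0: "0 \<le> r" using rY by (rule LIMSEQ_le_const) simp
  have nu: "norm u \<le> r" by (rule weakly_tendsto_norm_le[OF Y(2) rY])
  have nj: "norm j \<le> r"
    using weakly_tendsto_norm_le[OF j] r by (simp add: norm_J)
  have r_eq: "norm u = r"
  proof (cases "r = 0")
    case False
    have "r\<^sup>2 \<le> norm j * norm u" using blinfun_le_norm[of j u] ju by simp
    also have "\<dots> \<le> r * norm u" using nj by (intro mult_right_mono) auto
    finally have "r \<le> norm u" using False r0 by (simp add: power2_eq_square)
    with nu show ?thesis by simp
  qed (use nu in simp)
  have "norm j = r"
  proof (cases "r = 0")
    case False
    have "r\<^sup>2 \<le> norm j * r" using blinfun_le_norm[of j u] ju r_eq by simp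
    then have "r \<le> norm j" using False r0 by (simp add: power2_eq_square)
    with nj show ?thesis by simp
  qed (use nj in simp)
  then have "j = J u" using ju r_eq by (intro J_eqI) auto
  then show "z = T u" using key by (auto simp: z_eq T_def r_eq)
qed

text \<open>Supplies the continuity that Ky Fan requires. Under strong convergence the boundedness
  of \<open>T\<close> gives \<open>c = <z, u>\<close>, so \<open>pseudo_limit\<close> identifies the
  weak limit along a further subsequence of any subsequence.\<close>

lemma T_demicontinuous:
  assumes X: "\<And>n. X n \<in> D" "u \<in> D" "X \<longlonglongrightarrow> u"
  shows "(\<lambda>n. blinfun_apply (T (X n)) (X n - v)) \<longlonglongrightarrow> blinfun_apply (T u) (u - v)"
proof (rule ccontr)
  let ?a = "\<lambda>n. blinfun_apply (T (X n)) (X n - v)"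
  assume "\<not> ?a \<longlonglongrightarrow> blinfun_apply (T u) (u - v)"
  then obtain d where d: "d > 0" "\<not> (\<forall>\<^sub>F n in sequentially. dist (?a n) (blinfun_apply (T u) (u - v)) < d)"
    by (auto simp: tendsto_iff)
  obtain r :: "nat \<Rightarrow> nat" where r: "strict_mono r" "\<forall>n. \<not> dist (?a (r n)) (blinfun_apply (T u) (u - v)) < d"
    using not_eventually_sequentiallyD[OF d(2)] by blast
  define Y where "Y = (\<lambda>n. X (r n))"
  have Y: "Y \<longlonglongrightarrow> u" using LIMSEQ_subseq_LIMSEQ[OF X(3) r(1)] by (simp add: Y_def comp_def)
  have bY: "bounded (range Y)" using convergent_imp_bounded[OF Y] .
  have bT: "bounded (range (\<lambda>n. T (Y n)))" using X(1) bY by (intro T_bounded_seq) (auto simp: Y_def)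
  obtain s x z \<gamma> where s: "strict_mono s" "weakly_tendsto (\<lambda>n. Y (s n)) x" "weakly_tendsto (\<lambda>n. T (Y (s n))) z"
    "(\<lambda>n. blinfun_apply (T (Y (s n))) (Y (s n))) \<longlonglongrightarrow> \<gamma>"
    by (rule joint_weak_subseq[OF refl reflexive_space_dual[OF refl] bY bT bounded_range_blinfun_apply[OF bT bY]])
      (rule that)
  define Z where "Z = (\<lambda>n. Y (s n))"
  have Z: "Z \<longlonglongrightarrow> u" "\<And>n. Z n \<in> D" "bounded (range Z)"
    using LIMSEQ_subseq_LIMSEQ[OF Y s(1)] X(1) bounded_subset[OF bY, of "range Z"]
    by (auto simp: Z_def Y_def comp_def)
  obtain B where B: "\<And>n. norm (T (Z n)) \<le> B"
    using bT by (auto simp: bounded_iff Z_def)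
  have zD: "(\<lambda>n. blinfun_apply (T (Z n)) x) \<longlonglongrightarrow> blinfun_apply z x" for x
    using weakly_tendsto_dualD[OF s(3)] by (simp add: Z_def)
  have "(\<lambda>n. blinfun_apply (T (Z n)) (Z n - u)) \<longlonglongrightarrow> 0"
  proof (rule tendsto_0_le[of "\<lambda>n. Z n - u" _ _ B])
    show "(\<lambda>n. Z n - u) \<longlonglongrightarrow> 0" using Z(1) by (simp add: LIM_zero)
    have "norm (blinfun_apply (T (Z n)) (Z n - u)) \<le> norm (Z n - u) * B" for n
      using norm_blinfun[of "T (Z n)" "Z n - u"] mult_right_mono[OF B[of n], of "norm (Z n - u)"]
      by (simp add: mult.commute)
    then show "\<forall>\<^sub>F n in sequentially. norm (blinfun_apply (T (Z n)) (Z n - u)) \<le> norm (Z n - u) * B" by simp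
  qed
  from tendsto_add[OF this zD[of u]]
  have lim: "(\<lambda>n. blinfun_apply (T (Z n)) (Z n)) \<longlonglongrightarrow> blinfun_apply z u" by (simp add: blinfun.diff_right)
  have "z = T u"
    using pseudo_limit(1)[OF Z(2) X(2) tendsto_imp_weakly_tendsto[OF Z(1)] Z(3) _ lim] s(3) by (simp add: Z_def)
  then have "(\<lambda>n. blinfun_apply (T (Z n)) (Z n - v)) \<longlonglongrightarrow> blinfun_apply (T u) (u - v)"
    using tendsto_diff[OF lim zD[of v]] by (simp add: blinfun.diff_right)
  then have "\<forall>\<^sub>F n in sequentially. dist (blinfun_apply (T (Z n)) (Z n - v)) (blinfun_apply (T u) (u - v)) < d"
    using d(1) by (auto simp: tendsto_iff)
  then obtain n where "dist (blinfun_apply (T (Z n)) (Z n - v)) (blinfun_apply (T u) (u - v)) < d"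
    using eventually_happens'[OF sequentially_bot] by blast
  then show False using spec[OF r(2), of "s n"] by (simp add: Z_def Y_def)
qed

text \<open>Ky Fan over convex combinations of the elements of \<open>F\<close>. In the weighted sum
  of the constraints the \<open>T\<close> terms cancel; convexity of \<open>lag\<close> bounds the
  rest by \<open>- <q, x> - lag (x, q)\<close> at the combination \<open>(x, q)\<close>, which is
  nonpositive by \<open>lag_ge\<close>.\<close>

lemma Galerkin_point:
  assumes F: "finite F" "F \<noteq> {}" "F \<subseteq> Dom L"
  shows "\<exists>x\<in>Dom1 L. \<forall>(y, q)\<in>F. blinfun_apply (T x) (x - y) - blinfun_apply q x - lag (y, q) \<le> 0"
proof -
  obtain m e where Fe: "F = e ` {i::nat. i < m}"
    using finite_imp_nat_seg_image_inj_on[OF F(1)] by blast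
  have m: "0 < m" using F(2) Fe by (cases m) auto
  have eD: "e i \<in> Dom L" if "i < m" for i using that F(3) Fe by auto
  define \<Delta> where "\<Delta> = {t. (\<forall>i<m. 0 \<le> t i) \<and> (\<Sum>i<m. t i) = (1::real)}"
  define x where "x t = (\<Sum>i<m. t i *\<^sub>R e i)" for t
  define G where "G t i = blinfun_apply (T (fst (x t))) (fst (x t) - fst (e i)) - blinfun_apply (snd (e i)) (fst (x t)) - lag (e i)"
    for t i
  have xD: "x t \<in> Dom L" if "t \<in> \<Delta>" for t
    unfolding x_def using that eD by (intro convex_sum convex_Dom) (auto simp: \<Delta>_def)
  have x1: "fst (x t) \<in> Dom1 L" if "t \<in> \<Delta>" for t using xD[OF that] by (auto simp: Dom1_eq)
  have "\<exists>t\<in>\<Delta>. \<forall>i<m. G t i \<le> 0"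
  proof (rule Ky_Fan_simplex[OF m, of G, folded \<Delta>_def])
    fix X :: "nat \<Rightarrow> nat \<Rightarrow> real" and t i
    assume X: "\<And>k. X k \<in> \<Delta>" "t \<in> \<Delta>" and lim: "\<And>j. j < m \<Longrightarrow> (\<lambda>k. X k j) \<longlonglongrightarrow> t j" and i: "i < m"
    have "(\<lambda>k. x (X k)) \<longlonglongrightarrow> x t" unfolding x_def by (intro tendsto_intros lim) auto
    then have xl: "(\<lambda>k. fst (x (X k))) \<longlonglongrightarrow> fst (x t)" by (rule tendsto_fst)
    have "fst (x (X k)) \<in> D" "fst (x t) \<in> D" for k using x1 X Dom1_subset by blast+
    then show "(\<lambda>k. G (X k) i) \<longlonglongrightarrow> G t i"
      unfolding G_def by (intro tendsto_intros T_demicontinuous xl blinfun.tendsto)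
  next
    fix t assume t: "t \<in> \<Delta>"
    define a where "a = fst (x t)"
    have nn: "\<And>i. i < m \<Longrightarrow> 0 \<le> t i" and sum1: "(\<Sum>i<m. t i) = 1" using t by (auto simp: \<Delta>_def)
    have fs: "a = (\<Sum>i<m. t i *\<^sub>R fst (e i))" "snd (x t) = (\<Sum>i<m. t i *\<^sub>R snd (e i))"
      by (simp_all add: a_def x_def fst_sum snd_sum)
    have 1: "(\<Sum>i<m. t i * blinfun_apply (T a) (fst (e i))) = blinfun_apply (T a) a"
      by (subst (2) fs(1)) (simp add: blinfun.sum_right blinfun.scaleR_right)
    have 2: "(\<Sum>i<m. t i * blinfun_apply (snd (e i)) a) = blinfun_apply (snd (x t)) a"
      by (subst fs(2)) (simp add: blinfun.sum_left blinfun.scaleR_left)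
    have 3: "lag (x t) \<le> (\<Sum>i<m. t i * lag (e i))"
      unfolding x_def using m nn sum1 eD by (intro convex_on_sum[OF _ _ convex_on_lag]) auto
    have "(\<Sum>i<m. t i * G t i) = (\<Sum>i<m. t i) * blinfun_apply (T a) a - (\<Sum>i<m. t i * blinfun_apply (T a) (fst (e i)))
      - (\<Sum>i<m. t i * blinfun_apply (snd (e i)) a) - (\<Sum>i<m. t i * lag (e i))"
      by (simp add: G_def a_def[symmetric] blinfun.diff_right right_diff_distrib sum_subtractf sum_distrib_right)
    also have "\<dots> \<le> - blinfun_apply (snd (x t)) a - lag (x t)" using 1 2 3 sum1 by simp
    also have "\<dots> \<le> 0" using lag_ge[of a "snd (x t)"] xD[OF t] by (simp add: a_def)
    finally show "(\<Sum>i<m. t i * G t i) \<le> 0" .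
  qed blast
  then obtain t where "t \<in> \<Delta>" "\<And>i. i < m \<Longrightarrow> G t i \<le> 0" by blast
  then show ?thesis
    using x1[of t] by (intro bexI[of _ "fst (x t)"]) (auto simp: Fe G_def case_prod_beta)
qed

end

lemma finite_subset_UN_incseq:
  assumes "incseq S" "finite F" "F \<subseteq> (\<Union>n. S n)"
  obtains k where "F \<subseteq> S k"
proof -
  obtain i where i: "\<And>x. x \<in> F \<Longrightarrow> x \<in> S (i x)" using assms(3) by (metis UN_E subsetD)
  have "F \<subseteq> S (Max (insert 0 (i ` F)))"
  proof
    fix x assume "x \<in> F"
    then have "i x \<le> Max (insert 0 (i ` F))" using assms(2) by (intro Max_ge) auto
    with i[OF \<open>x \<in> F\<close>] incseqD[OF assms(1)] show "x \<in> S (Max (insert 0 (i ` F)))" by blast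
  qed
  then show ?thesis by (rule that)
qed

context pseudo_regular_perturbation
begin

text \<open>
  The Galerkin points are taken along the finite subsets of a countable set \<open>S\<close>, so that sequential
  compactness suffices. For a weak limit to see all of the graph it is enough that \<open>S\<close> contains
  the resolvents at points \<open>(a, b)\<close> arbitrarily close to the limit \<open>(u, z)\<close> of \<open>(x, T x)\<close>, and
  rational combinations of the pairs \<open>(x, T x)\<close> are such points.
\<close>

lemma countable_resolvent_closed_set:
  obtains S gp where "countable S" "S \<subseteq> Dom L" "(0, 0) \<in> S"
    "\<And>F. finite F \<Longrightarrow> F \<noteq> {} \<Longrightarrow> F \<subseteq> S \<Longrightarrow> gp F \<in> Dom1 L \<and>
      (\<forall>(y, q)\<in>F. blinfun_apply (T (gp F)) (gp F - y) - blinfun_apply q (gp F) - lag (y, q) \<le> 0)"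
    "\<And>a b. (a, b) \<in> rational_span ((\<lambda>F. (gp F, T (gp F))) ` {F. finite F \<and> F \<noteq> {} \<and> F \<subseteq> S}) \<Longrightarrow>
      \<exists>y. (y, b + J (y - a)) \<in> S \<and> (y, - b - J (y - a)) \<in> graph"
proof -
  define gal where "gal F x \<longleftrightarrow> x \<in> Dom1 L \<and>
      (\<forall>(y, q)\<in>F. blinfun_apply (T x) (x - y) - blinfun_apply q x - lag (y, q) \<le> 0)" for F x
  have "\<exists>x. finite F \<and> F \<noteq> {} \<and> F \<subseteq> Dom L \<longrightarrow> gal F x" for F
    using Galerkin_point[of F] unfolding gal_def by blast
  then obtain gp where gp: "\<And>F. finite F \<Longrightarrow> F \<noteq> {} \<Longrightarrow> F \<subseteq> Dom L \<Longrightarrow> gal F (gp F)"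
    by metis
  have "\<forall>w. \<exists>y. (y, - snd w - J (y - fst w)) \<in> graph" using graph_resolvent by blast
  then obtain res where res: "\<And>w. (res w, - snd w - J (res w - fst w)) \<in> graph" by metis
  define A where "A S = (\<lambda>F. (gp F, T (gp F))) ` {F. finite F \<and> F \<noteq> {} \<and> F \<subseteq> S}" for S
  define R where "R w = (res w, snd w + J (res w - fst w))" for w
  \<comment> \<open>\<open>S\<close> has to contain resolvents at rational combinations of Galerkin
    pairs that are themselves defined from \<open>S\<close>. With \<open>gp\<close> and
    \<open>res\<close> chosen once, iteration breaks the circle: a rational combination involves
    finitely many finite sets, all inside one stage.\<close>
  define step where "step S = S \<union> R ` rational_span (A S)" for S
  define S where "S n = (step ^^ n) {(0, 0)}" for n
  have S0: "S 0 = {(0, 0)}" and SS: "S (Suc n) = step (S n)" for n by (simp_all add: S_def)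
  have inc: "incseq S" by (rule incseq_SucI) (auto simp: SS step_def)
  have RD: "R w \<in> Dom L" for w using res[of w] by (simp add: R_def graph_def add.commute[of "snd w"])
  have "countable (S n) \<and> S n \<subseteq> Dom L" for n
  proof (induction n)
    case 0
    then show ?case using zero_Dom by (simp add: S0)
  next
    case (Suc n)
    have "countable {F. finite F \<and> F \<subseteq> S n}" using Suc by (intro countable_Collect_finite_subset) simp
    then have "countable {F. finite F \<and> F \<noteq> {} \<and> F \<subseteq> S n}" by (rule countable_subset[rotated]) auto
    then have "countable (A (S n))" unfolding A_def by (rule countable_image)
    then show ?case using Suc RD by (auto simp: SS step_def intro: countable_rational_span)
  qed
  then have cS: "countable (\<Union>n. S n)" and DS: "(\<Union>n. S n) \<subseteq> Dom L" by auto
  show ?thesis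
  proof (rule that[OF cS DS])
    show "(0, 0) \<in> (\<Union>n. S n)" using S0 by blast
    fix F assume "finite F" "F \<noteq> {}" "F \<subseteq> (\<Union>n. S n)"
    then show "gp F \<in> Dom1 L \<and>
      (\<forall>(y, q)\<in>F. blinfun_apply (T (gp F)) (gp F - y) - blinfun_apply q (gp F) - lag (y, q) \<le> 0)"
      using gp[unfolded gal_def, of F] DS by blast
  next
    fix a b assume "(a, b) \<in> rational_span ((\<lambda>F. (gp F, T (gp F))) ` {F. finite F \<and> F \<noteq> {} \<and> F \<subseteq> (\<Union>n. S n)})"
    then have "(a, b) \<in> rational_span (A (\<Union>n. S n))" by (simp add: A_def)
    then obtain E where E: "finite E" "E \<subseteq> A (\<Union>n. S n)" "(a, b) \<in> rational_span E"
      by (rule rational_span_finite_support)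
    obtain \<G> where \<G>: "\<G> \<subseteq> {F. finite F \<and> F \<noteq> {} \<and> F \<subseteq> (\<Union>n. S n)}" "finite \<G>"
      "E = (\<lambda>F. (gp F, T (gp F))) ` \<G>"
      using finite_subset_image[OF E(1) E(2)[unfolded A_def]] by blast
    have "finite (\<Union>\<G>)" "\<Union>\<G> \<subseteq> (\<Union>n. S n)" using \<G>(1,2) by auto
    then obtain k where k: "\<Union>\<G> \<subseteq> S k" using finite_subset_UN_incseq[OF inc] by blast
    then have "\<G> \<subseteq> {F. finite F \<and> F \<noteq> {} \<and> F \<subseteq> S k}" using \<G>(1) by blast
    then have "E \<subseteq> A (S k)" unfolding A_def \<G>(3) by (rule image_mono)
    then have "(a, b) \<in> rational_span (A (S k))" using E(3) rational_span_mono by blast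
    then have "R (a, b) \<in> S (Suc k)" by (simp add: SS step_def)
    then have "(res (a, b), b + J (res (a, b) - a)) \<in> (\<Union>n. S n)" by (auto simp: R_def)
    then show "\<exists>y. (y, b + J (y - a)) \<in> (\<Union>n. S n) \<and> (y, - b - J (y - a)) \<in> graph"
      using res[of "(a, b)"] by (intro exI[of _ "res (a, b)"]) simp
  qed
qed

text \<open>The bound \<open>lag (0, 0)\<close> is what the constraint at \<open>(0, 0)\<close>
  yields. That pair is put into every finite set, so the hypothesis bounds all Galerkin
  points.\<close>

theorem coercive_inclusion_exists:
  assumes coercive: "\<And>x. x \<in> Dom1 L \<Longrightarrow> blinfun_apply (T x) x \<le> lag (0, 0) \<Longrightarrow> norm x \<le> R"
  shows "\<exists>u. (u, - T u) \<in> graph"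
proof -
  obtain S gp where S: "countable S" "S \<subseteq> Dom L" "(0, 0) \<in> S"
    and gp: "\<And>F. finite F \<Longrightarrow> F \<noteq> {} \<Longrightarrow> F \<subseteq> S \<Longrightarrow> gp F \<in> Dom1 L \<and>
      (\<forall>(y, q)\<in>F. blinfun_apply (T (gp F)) (gp F - y) - blinfun_apply q (gp F) - lag (y, q) \<le> 0)"
    and res: "\<And>a b. (a, b) \<in> rational_span ((\<lambda>F. (gp F, T (gp F))) ` {F. finite F \<and> F \<noteq> {} \<and> F \<subseteq> S}) \<Longrightarrow>
      \<exists>y. (y, b + J (y - a)) \<in> S \<and> (y, - b - J (y - a)) \<in> graph"
    by (rule countable_resolvent_closed_set) (rule that)
  define A where "A = (\<lambda>F. (gp F, T (gp F))) ` {F. finite F \<and> F \<noteq> {} \<and> F \<subseteq> S}"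
  define s where "s = from_nat_into S"
  have s: "range s = S" unfolding s_def using S by (intro range_from_nat_into) auto
  define F where "F n = insert (0, 0) (s ` {..n})" for n
  have F: "finite (F n)" "F n \<noteq> {}" "F n \<subseteq> S" for n using s S(3) by (auto simp: F_def)
  define X where "X = (\<lambda>n. gp (F n))"
  have X1: "X n \<in> Dom1 L" for n using gp[OF F] by (simp add: X_def)
  have XD: "X n \<in> D" for n using X1 Dom1_subset by blast
  have XF: "blinfun_apply (T (X n)) (X n - y) - blinfun_apply q (X n) - lag (y, q) \<le> 0" if "(y, q) \<in> F n" for n y q
    using gp[OF F, of n] that by (auto simp: X_def)
  have XA: "(X n, T (X n)) \<in> A" for n using F by (auto simp: A_def X_def)
  have "norm (X n) \<le> R" for n using XF[of 0 0 n] X1[of n] coercive by (simp add: F_def)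
  then have bX: "bounded (range X)" by (auto simp: bounded_iff)
  have bT: "bounded (range (\<lambda>n. T (X n)))" by (rule T_bounded_seq[OF XD bX])
  obtain r u z c where r: "strict_mono r" and u: "weakly_tendsto (\<lambda>n. X (r n)) u"
    and z: "weakly_tendsto (\<lambda>n. T (X (r n))) z" and c: "(\<lambda>n. blinfun_apply (T (X (r n))) (X (r n))) \<longlonglongrightarrow> c"
    by (rule joint_weak_subseq[OF refl reflexive_space_dual[OF refl] bX bT bounded_range_blinfun_apply[OF bT bX]])
      (rule that)
  have uD: "u \<in> D"
    using weakly_tendsto_in_closed_convex[OF closed_Dom1 convex_Dom1 X1 u] Dom1_subset by blast
  have limS: "c - blinfun_apply z y - blinfun_apply q u - lag (y, q) \<le> 0" if yq: "(y, q) \<in> S" for y q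
  proof (rule LIMSEQ_le_const2)
    show "(\<lambda>n. blinfun_apply (T (X (r n))) (X (r n)) - blinfun_apply (T (X (r n))) y - blinfun_apply q (X (r n)) - lag (y, q))
        \<longlonglongrightarrow> c - blinfun_apply z y - blinfun_apply q u - lag (y, q)"
      using u[unfolded weakly_tendsto_def, rule_format, of q]
      by (intro tendsto_diff tendsto_const c weakly_tendsto_dualD[OF z])
    obtain k where k: "(y, q) = s k" using yq s by (metis imageE)
    have "(y, q) \<in> F (r n)" if "k \<le> n" for n
      using that strict_mono_imp_increasing[OF r, of n] k by (auto simp: F_def)
    then show "\<exists>N. \<forall>n\<ge>N. blinfun_apply (T (X (r n))) (X (r n)) - blinfun_apply (T (X (r n))) y
        - blinfun_apply q (X (r n)) - lag (y, q) \<le> 0"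
      using XF by (auto simp: blinfun.diff_right intro!: exI[of _ k])
  qed
  \<comment> \<open>Strong approximants of \<open>(u, z)\<close> are needed in the rational span,
    because only there does \<open>S\<close> contain the resolvents.\<close>
  have "(X (r n), T (X (r n))) \<in> closure (rational_span A)" for n
    using XA rational_span_superset closure_subset by blast
  then have "(u, z) \<in> closure (rational_span A)"
    by (rule weakly_tendsto_in_closed_convex[OF closed_closure
        subspace_imp_convex[OF subspace_closure_rational_span] _ weakly_tendsto_Pair[OF u z]])
  then obtain W where W: "\<And>k. W k \<in> rational_span A" "W \<longlonglongrightarrow> (u, z)" by (auto simp: closure_sequential)
  define a b where "a k = fst (W k)" and "b k = snd (W k)" for k
  have "\<exists>y. (y, b k + J (y - a k)) \<in> S \<and> (y, - b k - J (y - a k)) \<in> graph" for k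
    using res[of "a k" "b k"] W(1)[of k] by (simp add: A_def a_def b_def)
  then obtain y where y: "\<And>k. (y k, b k + J (y k - a k)) \<in> S" "\<And>k. (y k, - b k - J (y k - a k)) \<in> graph" by metis
  define t \<delta> \<epsilon> where "t k = norm (y k - a k)" and "\<delta> k = norm (a k - u)" and "\<epsilon> k = norm (z - b k)" for k
  have a: "a \<longlonglongrightarrow> u" and b: "b \<longlonglongrightarrow> z"
    unfolding a_def b_def using tendsto_fst[OF W(2)] tendsto_snd[OF W(2)] by simp_all
  have \<delta>: "\<delta> \<longlonglongrightarrow> 0" unfolding \<delta>_def using tendsto_norm_zero[OF LIM_zero[OF a]] .
  have \<epsilon>: "\<epsilon> \<longlonglongrightarrow> 0" unfolding \<epsilon>_def using tendsto_norm_zero[OF LIM_zero[OF b]] by (simp add: norm_minus_commute)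
  \<comment> \<open>For \<open>(a, b) = (u, z)\<close> this would read
    \<open>c - <z, u> + t^2 <= 0\<close>. The approximation enters through \<open>\<epsilon>\<close>
    and \<open>\<delta>\<close> only, and the products with \<open>t\<close> are afterwards absorbed
    by half of \<open>t^2\<close>.\<close>
  have est: "c - blinfun_apply z u + (t k)\<^sup>2 \<le> t k * (\<epsilon> k + \<delta> k) + \<epsilon> k * \<delta> k" for k
  proof -
    define p where "p = J (y k - a k)"
    have p: "blinfun_apply p (y k - a k) = (t k)\<^sup>2" "norm p = t k"
      using J_self[of "y k - a k"] norm_J[of "y k - a k"] by (simp_all add: p_def t_def)
    have "lag (y k, b k + p) \<le> - blinfun_apply (b k + p) (y k)"
      using y(2)[of k]
      by (simp add: graph_def p_def blinfun.minus_left blinfun.diff_left blinfun.add_left add.commute[of "b k"])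
    with limS[OF y(1)[of k]] have 1: "c - blinfun_apply z (y k) + blinfun_apply (b k + p) (y k - u) \<le> 0"
      by (simp add: p_def blinfun.diff_right)
    have "blinfun_apply (z - b k) (y k - u) \<le> \<epsilon> k * norm (y k - u)"
      unfolding \<epsilon>_def by (rule blinfun_le_norm)
    also have "\<dots> \<le> \<epsilon> k * (t k + \<delta> k)"
      using norm_triangle_ineq[of "y k - a k" "a k - u"] by (intro mult_left_mono) (auto simp: t_def \<delta>_def \<epsilon>_def)
    finally have 2: "blinfun_apply (z - b k) (y k - u) \<le> \<epsilon> k * (t k + \<delta> k)" .
    have 3: "- blinfun_apply p (a k - u) \<le> t k * \<delta> k"
      using blinfun_le_norm[of "- p" "a k - u"] by (simp add: p(2) \<delta>_def blinfun.minus_left)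
    have "blinfun_apply p (y k - u) = (t k)\<^sup>2 + blinfun_apply p (a k - u)"
      using p(1) by (simp add: blinfun.diff_right)
    then show ?thesis
      using 1 2 3 by (simp add: blinfun.diff_right blinfun.diff_left blinfun.add_left algebra_simps)
  qed
  have sq: "t k * (\<epsilon> k + \<delta> k) \<le> (t k)\<^sup>2 / 2 + (\<epsilon> k + \<delta> k)\<^sup>2 / 2" for k
    using sum_squares_bound[of "t k" "\<epsilon> k + \<delta> k"] unfolding mult.assoc by linarith
  have err: "(\<lambda>k. (\<epsilon> k + \<delta> k)\<^sup>2 + 2 * (\<epsilon> k * \<delta> k)) \<longlonglongrightarrow> 0"
  proof -
    have "(\<lambda>k. (\<epsilon> k + \<delta> k)\<^sup>2 + 2 * (\<epsilon> k * \<delta> k)) \<longlonglongrightarrow> (0 + 0)\<^sup>2 + 2 * (0 * 0)"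
      by (intro tendsto_intros \<epsilon> \<delta>)
    then show ?thesis by simp
  qed
  have "2 * (c - blinfun_apply z u) \<le> 0"
  proof (rule LIMSEQ_le_const[OF err])
    have "2 * (c - blinfun_apply z u) \<le> (\<epsilon> k + \<delta> k)\<^sup>2 + 2 * (\<epsilon> k * \<delta> k)" for k
      using est[of k] sq[of k] zero_le_power2[of "t k"] by argo
    then show "\<exists>N. \<forall>n\<ge>N. 2 * (c - blinfun_apply z u) \<le> (\<epsilon> n + \<delta> n)\<^sup>2 + 2 * (\<epsilon> n * \<delta> n)" by blast
  qed
  then have "c \<le> blinfun_apply z u" by simp
  moreover have "bounded (range (\<lambda>n. X (r n)))" using bX by (rule bounded_subset) auto
  ultimately have zT: "z = T u" and cz: "c = blinfun_apply z u"
    using pseudo_limit[OF XD uD u _ z c] by auto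
  \<comment> \<open>With \<open>c = <z, u>\<close> established, the same estimate controls
    \<open>t\<close>; the resolvents converge strongly to \<open>u\<close> and the closedness of the
    graph applies.\<close>
  have "(\<lambda>k. (t k)\<^sup>2) \<longlonglongrightarrow> 0"
  proof (rule tendsto_sandwich[OF _ _ tendsto_const err])
    have "(t k)\<^sup>2 \<le> (\<epsilon> k + \<delta> k)\<^sup>2 + 2 * (\<epsilon> k * \<delta> k)" for k
      using est[of k] sq[of k] cz by argo
    then show "\<forall>\<^sub>F k in sequentially. (t k)\<^sup>2 \<le> (\<epsilon> k + \<delta> k)\<^sup>2 + 2 * (\<epsilon> k * \<delta> k)" by simp
  qed simp
  from tendsto_real_sqrt[OF this] have "(\<lambda>k. norm (y k - a k)) \<longlonglongrightarrow> 0" by (simp add: t_def)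
  then have ya: "(\<lambda>k. y k - a k) \<longlonglongrightarrow> 0" by (rule tendsto_norm_zero_cancel)
  from tendsto_add[OF this a] have yl: "y \<longlonglongrightarrow> u" by simp
  have "(\<lambda>k. J (y k - a k)) \<longlonglongrightarrow> 0"
    using tendsto_norm_zero[OF ya] by (intro tendsto_norm_zero_cancel[of "\<lambda>k. J (y k - a k)"]) (simp add: norm_J)
  from tendsto_diff[OF tendsto_minus[OF b] this]
  have "(\<lambda>k. - b k - J (y k - a k)) \<longlonglongrightarrow> - z" by simp
  from graph_closed[OF y(2) yl this] show ?thesis using zT by auto
qed

end

section \<open>Regularization\<close>

context asd_lagrangian
begin

text \<open>
  Beyond radius \<open>N + 1\<close> the cut-off switches \<open>\<Lambda>\<close> off while the weight of \<open>J\<close> grows, which makes the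
  modified map coercive. The growth condition on the graph confines the solution to radius \<open>N\<close>,
  where nothing was modified.
\<close>

lemma regularized_inclusion_exists:
  assumes zero: "(0, 0) \<in> Dom L" and closed: "closed (Dom1 L)"
    and bdd: "bounded_map D \<Lambda>" and regular: "pseudo_regular D \<Lambda>" and sub: "Dom1 L \<subseteq> D"
    and growth: "\<And>x p. (x, p) \<in> graph \<Longrightarrow> R \<le> norm x \<Longrightarrow> - C * (norm x + 1) \<le> blinfun_apply (p + \<Lambda> x) x"
    and \<epsilon>: "0 < \<epsilon>" and C: "0 < C"
  shows "\<exists>u. (u, - (\<Lambda> u + \<epsilon> *\<^sub>R J u)) \<in> graph"
proof -
  \<comment> \<open>For \<open>r >= N\<close> both \<open>r >= 1\<close> and
    \<open>\<epsilon> * r > 2 * C\<close> hold, hence \<open>\<epsilon> * r^2 > C * (r + 1)\<close>.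
    This contradicts the growth condition, which is available from radius \<open>R\<close>
    on.\<close>
  define N where "N = max (max R 1) (2 * C / \<epsilon> + 1)"
  have N: "R \<le> N" "1 \<le> N" "2 * C / \<epsilon> < N" by (auto simp: N_def)
  have "bounded (\<Lambda> ` {x \<in> D. norm x \<le> N + 2})"
    using bdd[unfolded bounded_map_def, rule_format, of "{x \<in> D. norm x \<le> N + 2}"]
    by (auto simp: bounded_iff)
  then obtain B where B: "\<And>x. x \<in> D \<Longrightarrow> norm x \<le> N + 2 \<Longrightarrow> norm (\<Lambda> x) \<le> B" and B0: "0 < B"
    by (auto simp: bounded_pos)
  \<comment> \<open>\<open>B\<close> pays for the cut-off \<open>\<Lambda>\<close>, which lives in
    the ball of radius \<open>N + 2\<close>. The rest lifts the pairing strictly above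
    \<open>lag (0, 0)\<close> from radius \<open>N + 1\<close> on, where the factor of
    \<open>M\<close> in \<open>g\<close> has reached 1.\<close>
  define M where "M = B + \<bar>lag (0, 0)\<bar> + 1"
  define \<theta> where "\<theta> r = max 0 (min 1 (N + 2 - r))" for r :: real
  define g where "g r = \<epsilon> + M * max 0 (r - N)" for r :: real
  have M0: "0 < M" using B0 by (simp add: M_def)
  interpret P: pseudo_regular_perturbation L J D \<Lambda> \<theta> g
  proof
    show "continuous_on UNIV \<theta>" unfolding \<theta>_def by (intro continuous_intros)
    show "continuous_on UNIV g" unfolding g_def by (intro continuous_intros)
    show "0 < g r" for r using \<epsilon> M0 by (auto simp: g_def intro!: add_pos_nonneg)
  qed (use zero closed bdd regular sub in \<open>auto simp: \<theta>_def\<close>)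
  have coercive: "lag (0, 0) < blinfun_apply (P.T x) x" if x: "x \<in> D" "N + 1 \<le> norm x" for x
  proof -
    have n1: "1 \<le> norm x" using x(2) N(2) by simp
    have "norm (\<theta> (norm x) *\<^sub>R \<Lambda> x) \<le> B"
    proof (cases "norm x \<le> N + 2")
      case True
      have "\<theta> (norm x) * norm (\<Lambda> x) \<le> 1 * B"
        using B[OF x(1) True] by (intro mult_mono) (auto simp: \<theta>_def)
      then show ?thesis by (simp add: \<theta>_def)
    next
      case False
      then show ?thesis using B0 by (simp add: \<theta>_def)
    qed
    then have "- blinfun_apply (\<theta> (norm x) *\<^sub>R \<Lambda> x) x \<le> B * norm x"
      using blinfun_le_norm[of "- (\<theta> (norm x) *\<^sub>R \<Lambda> x)" x] mult_right_mono[of _ B "norm x"]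
      by (fastforce simp: blinfun.minus_left intro: order_trans)
    moreover have "M * norm x \<le> g (norm x) * (norm x)\<^sup>2"
    proof -
      have "M * 1 \<le> M * max 0 (norm x - N)" using M0 x(2) by (intro mult_left_mono) auto
      then have "M \<le> g (norm x)" using \<epsilon> by (simp add: g_def)
      moreover have "norm x \<le> (norm x)\<^sup>2" using mult_left_mono[OF n1, of "norm x"] by (simp add: power2_eq_square)
      ultimately show ?thesis using M0 by (intro mult_mono) auto
    qed
    moreover have "\<bar>lag (0, 0)\<bar> + 1 \<le> (\<bar>lag (0, 0)\<bar> + 1) * norm x"
      using mult_left_mono[OF n1, of "\<bar>lag (0, 0)\<bar> + 1"] by simp
    moreover have "M * norm x = B * norm x + (\<bar>lag (0, 0)\<bar> + 1) * norm x"
      by (simp add: M_def algebra_simps)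
    ultimately show ?thesis
      by (simp add: P.T_def blinfun.add_left blinfun.scaleR_left J_self)
  qed
  have "norm x \<le> N + 1" if "x \<in> Dom1 L" "blinfun_apply (P.T x) x \<le> lag (0, 0)" for x
    using coercive[of x] that sub by fastforce
  from P.coercive_inclusion_exists[OF this] obtain u where u: "(u, - P.T u) \<in> graph" by blast
  have uL: "(u, P.T u) \<in> Dom L" "lag (u, P.T u) \<le> - blinfun_apply (P.T u) u"
    using u by (auto simp: graph_def blinfun.minus_left)
  have uD: "u \<in> D" using uL(1) sub by (auto simp: Dom1_def Dom_def)
  have "blinfun_apply (P.T u) u \<le> lag (0, 0)" using Fenchel_Young[OF uL(1) zero] uL(2) by simp
  then have "norm u < N + 1" using coercive[OF uD] by fastforce
  then have Tu: "P.T u = \<Lambda> u + g (norm u) *\<^sub>R J u" by (simp add: P.T_def \<theta>_def)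
  have "norm u < N"
  proof (rule ccontr)
    assume "\<not> norm u < N"
    then have nu: "N \<le> norm u" by simp
    then have n1: "1 \<le> norm u" and uR: "R \<le> norm u" using N by auto
    have "- C * (norm u + 1) \<le> - (g (norm u) * (norm u)\<^sup>2)"
      using growth[OF u uR] by (simp add: Tu blinfun.add_left blinfun.diff_left blinfun.minus_left blinfun.scaleR_left J_self)
    moreover have "\<epsilon> * (norm u)\<^sup>2 \<le> g (norm u) * (norm u)\<^sup>2"
      using M0 by (intro mult_right_mono) (auto simp: g_def)
    moreover have "C * (norm u + 1) \<le> C * (2 * norm u)" using C n1 by (intro mult_left_mono) auto
    ultimately have "(\<epsilon> * norm u) * norm u \<le> (2 * C) * norm u" by (simp add: power2_eq_square)
    then have "\<epsilon> * norm u \<le> 2 * C" by (rule mult_right_le_imp_le) (use n1 in linarith)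
    moreover have "2 * C < \<epsilon> * norm u"
    proof -
      have "2 * C / \<epsilon> < norm u" using N(3) nu by simp
      then show ?thesis using \<epsilon> by (simp add: field_simps)
    qed
    ultimately show False by simp
  qed
  then have "P.T u = \<Lambda> u + \<epsilon> *\<^sub>R J u" by (simp add: Tu g_def)
  with u show ?thesis by auto
qed

text \<open>Along the solutions the expression in the coercivity condition is exactly 0. Coercivity
  ties the index of a sequence to the weight \<open>1 / n\<close>, however, so an unbounded
  subsequence cannot simply be renumbered.\<close>

lemma regularized_solutions_bounded:
  assumes coercive: "Lambda_coercive J D \<Lambda> L"
    and u: "\<And>n. 1 \<le> n \<Longrightarrow> u n \<in> D"
    and graph: "\<And>n. 1 \<le> n \<Longrightarrow> (u n, - (\<Lambda> (u n) + (1 / real n) *\<^sub>R J (u n))) \<in> graph"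
  shows "bounded (u ` {1..})"
proof (rule ccontr)
  assume unb: "\<not> bounded (u ` {1..})"
  have large: "\<exists>n>m. K \<le> norm (u n)" for m and K :: real
  proof (rule ccontr)
    assume "\<not> (\<exists>n>m. K \<le> norm (u n))"
    then have "u ` {1..} \<subseteq> u ` {..m} \<union> ball 0 K" by (auto simp: not_le) (meson atMost_iff image_eqI not_le)
    moreover have "bounded (u ` {..m} \<union> ball 0 K)" by (simp add: finite_imp_bounded)
    ultimately show False using unb bounded_subset by blast
  qed
  have "\<exists>\<sigma>. \<forall>k. (1 \<le> \<sigma> k \<and> real k \<le> norm (u (\<sigma> k))) \<and> \<sigma> k < \<sigma> (Suc k)"
  proof (rule dependent_nat_choice)
    show "\<exists>x. 1 \<le> x \<and> real 0 \<le> norm (u x)" by (intro exI[of _ 1]) simp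
    fix x n
    obtain n' where "x < n'" "real (Suc n) \<le> norm (u n')" using large by blast
    then show "\<exists>y. (1 \<le> y \<and> real (Suc n) \<le> norm (u y)) \<and> x < y" by (intro exI[of _ n']) auto
  qed
  then obtain \<sigma> where \<sigma>: "\<And>k. 1 \<le> \<sigma> k" "\<And>k. real k \<le> norm (u (\<sigma> k))" "strict_mono \<sigma>"
    by (auto simp: strict_mono_Suc_iff)
  \<comment> \<open>Solutions at indices in the range of \<open>\<sigma>\<close> stay at their own
    index. The gaps are filled with solutions of large norm, only to make the whole sequence
    diverge; the contradiction is read off along \<open>\<sigma>\<close>.\<close>
  define X where "X m = (if m \<in> range \<sigma> then u m else u (\<sigma> m))" for m
  have XD: "\<forall>n\<ge>1. X n \<in> D" using u \<sigma>(1) by (auto simp: X_def)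
  have "filterlim (\<lambda>n. norm (X n)) at_top sequentially"
    unfolding filterlim_at_top
  proof
    fix Z :: real
    obtain K :: nat where K: "Z \<le> real K" using real_arch_simple by blast
    have "Z \<le> norm (X m)" if m: "\<sigma> K \<le> m" for m
    proof (cases "m \<in> range \<sigma>")
      case True
      then obtain k where k: "m = \<sigma> k" by blast
      then have "K \<le> k" using m \<sigma>(3) by (simp add: strict_mono_less_eq)
      then show ?thesis using K \<sigma>(2)[of k] k by (simp add: X_def)
    next
      case False
      have "K \<le> m" using m strict_mono_imp_increasing[OF \<sigma>(3), of K] by simp
      then show ?thesis using K \<sigma>(2)[of m] False by (simp add: X_def)
    qed
    then show "\<forall>\<^sub>F n in sequentially. Z \<le> norm (X n)" by (auto simp: eventually_sequentially)
  qed
  then have "(\<lambda>n. L (X n, \<Lambda> (X n) + (1 / real n) *\<^sub>R J (X n)) +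
      ereal (blinfun_apply (\<Lambda> (X n)) (X n) + (1 / real n) * (norm (X n))\<^sup>2)) \<longlonglongrightarrow> \<infinity>" (is "?E \<longlonglongrightarrow> _")
    using coercive XD unfolding Lambda_coercive_def by blast
  then have lim: "(?E \<circ> \<sigma>) \<longlonglongrightarrow> \<infinity>" by (rule LIMSEQ_subseq_LIMSEQ) (rule \<sigma>(3))
  have "?E (\<sigma> k) = 0" for k
  proof -
    have X: "X (\<sigma> k) = u (\<sigma> k)" by (simp add: X_def)
    define p where "p = \<Lambda> (u (\<sigma> k)) + (1 / real (\<sigma> k)) *\<^sub>R J (u (\<sigma> k))"
    have "(u (\<sigma> k), p) \<in> Dom L" "lag (u (\<sigma> k), p) = - blinfun_apply p (u (\<sigma> k))"
      using graph[OF \<sigma>(1)[of k]] lag_ge[of "u (\<sigma> k)" p]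
      by (auto simp: graph_def p_def[symmetric] blinfun.minus_left)
    then have "L (X (\<sigma> k), p) = ereal (- blinfun_apply p (u (\<sigma> k)))" by (simp add: L_eq_lag X)
    moreover have "blinfun_apply p (u (\<sigma> k)) = blinfun_apply (\<Lambda> (u (\<sigma> k))) (u (\<sigma> k)) + (1 / real (\<sigma> k)) * (norm (u (\<sigma> k)))\<^sup>2"
      by (simp add: p_def blinfun.add_left blinfun.scaleR_left J_self)
    ultimately show ?thesis by (simp add: X p_def zero_ereal_def)
  qed
  then have "(\<lambda>k. 0 :: ereal) \<longlonglongrightarrow> \<infinity>" using lim by (simp add: comp_def)
  then show False using LIMSEQ_unique[OF tendsto_const] by force
qed

text \<open>The approximants now lie on the graph up to the \<open>J\<close> term, so monotonicity
  tests them against every graph element, and the exact resolvent at \<open>(u, z)\<close> is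
  available.\<close>

lemma regularized_limit:
  assumes closed: "closed (Dom1 L)" and bdd: "bounded_map D \<Lambda>" and regular: "pseudo_regular D \<Lambda>"
    and sub: "Dom1 L \<subseteq> D"
    and v: "bounded (range v)"
    and graph: "\<And>n. (v n, - (\<Lambda> (v n) + (1 / real (Suc n)) *\<^sub>R J (v n))) \<in> graph"
  shows "\<exists>u\<in>D. (u, - \<Lambda> u) \<in> graph"
proof -
  have v1: "v n \<in> Dom1 L" for n using graph[of n] by (auto simp: graph_def Dom1_def Dom_def)
  have vD: "v n \<in> D" for n using v1 sub by blast
  have b\<Lambda>: "bounded (range (\<lambda>n. \<Lambda> (v n)))"
    using bdd[unfolded bounded_map_def, rule_format, of "range v"] v vD by (auto simp: image_image)
  obtain r u z c where r: "strict_mono r" and u: "weakly_tendsto (\<lambda>n. v (r n)) u"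
    and z: "weakly_tendsto (\<lambda>n. \<Lambda> (v (r n))) z" and c: "(\<lambda>n. blinfun_apply (\<Lambda> (v (r n))) (v (r n))) \<longlonglongrightarrow> c"
    by (rule joint_weak_subseq[OF refl reflexive_space_dual[OF refl] v b\<Lambda> bounded_range_blinfun_apply[OF b\<Lambda> v]])
      (rule that)
  define w where "w = (\<lambda>n. v (r n))"
  have uD: "u \<in> D" using weakly_tendsto_in_closed_convex[OF closed convex_Dom1 v1 u] sub by blast
  have test: "c \<le> blinfun_apply z y + blinfun_apply p (y - u)" if yp: "(y, p) \<in> graph" for y p
  proof -
    have "bounded (range w)" using v by (rule bounded_subset) (auto simp: w_def)
    then obtain B where B: "\<And>n. norm (w n) \<le> B" by (auto simp: bounded_iff)
    define e where "e n = 1 / real (Suc (r n))" for n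
    have e: "e \<longlonglongrightarrow> 0"
      unfolding e_def using LIMSEQ_subseq_LIMSEQ[OF LIMSEQ_inverse_real_of_nat r]
      by (simp add: comp_def inverse_eq_divide)
    have "(\<lambda>n. e n * blinfun_apply (J (w n)) (w n - y)) \<longlonglongrightarrow> 0"
    proof (rule tendsto_0_le[OF e])
      have "\<bar>blinfun_apply (J (w n)) (w n - y)\<bar> \<le> B * (B + norm y)" for n
      proof -
        have "\<bar>blinfun_apply (J (w n)) (w n - y)\<bar> \<le> norm (w n) * norm (w n - y)"
          using norm_blinfun[of "J (w n)" "w n - y"] by (simp add: norm_J)
        also have "\<dots> \<le> B * (B + norm y)"
          using B[of n] norm_triangle_ineq4[of "w n" y] order_trans[OF norm_ge_zero B[of n]]
          by (intro mult_mono) auto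
        finally show ?thesis .
      qed
      then show "\<forall>\<^sub>F n in sequentially. norm (e n * blinfun_apply (J (w n)) (w n - y)) \<le> norm (e n) * (B * (B + norm y))"
        by (intro always_eventually allI) (auto simp: abs_mult intro: mult_left_mono)
    qed
    moreover have "(\<lambda>n. blinfun_apply p (w n)) \<longlonglongrightarrow> blinfun_apply p u"
      using u by (simp add: w_def weakly_tendsto_def)
    ultimately have "(\<lambda>n. - blinfun_apply (\<Lambda> (w n)) (w n) + blinfun_apply (\<Lambda> (w n)) y
        - e n * blinfun_apply (J (w n)) (w n - y) - blinfun_apply p (w n) + blinfun_apply p y)
      \<longlonglongrightarrow> - c + blinfun_apply z y - 0 - blinfun_apply p u + blinfun_apply p y"
      by (intro tendsto_add tendsto_diff tendsto_minus tendsto_const)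
        (use c weakly_tendsto_dualD[OF z] in \<open>auto simp: w_def\<close>)
    moreover have "0 \<le> - blinfun_apply (\<Lambda> (w n)) (w n) + blinfun_apply (\<Lambda> (w n)) y
        - e n * blinfun_apply (J (w n)) (w n - y) - blinfun_apply p (w n) + blinfun_apply p y" for n
      using graph_monotone[OF graph[of "r n", folded e_def] yp]
      by (simp add: w_def blinfun.diff_left blinfun.diff_right blinfun.add_left blinfun.minus_left
          blinfun.scaleR_left right_diff_distrib)
    ultimately have "0 \<le> - c + blinfun_apply z y - 0 - blinfun_apply p u + blinfun_apply p y"
      by (intro LIMSEQ_le_const) auto
    then show ?thesis by (simp add: blinfun.diff_right)
  qed
  \<comment> \<open>Testing with this \<open>y\<close> is used twice: without the square it gives
    the premise of pseudo-regularity, and the inequality \<open><z, u> <= c\<close> that follows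
    leaves no room for the square, so \<open>y = u\<close>.\<close>
  obtain y where y: "(y, - z - J (y - u)) \<in> graph" using graph_resolvent by blast
  have cy: "c + (norm (y - u))\<^sup>2 \<le> blinfun_apply z u"
    using test[OF y] J_self[of "y - u"] by (simp add: blinfun.diff_left blinfun.minus_left blinfun.diff_right)
  have "c \<le> blinfun_apply z u" using cy zero_le_power2[of "norm (y - u)"] by linarith
  have "(\<lambda>n. blinfun_apply (\<Lambda> (w n)) (w n - u)) \<longlonglongrightarrow> c - blinfun_apply z u"
    unfolding blinfun.diff_right w_def by (intro tendsto_diff c weakly_tendsto_dualD[OF z])
  then have "limsup (\<lambda>n. ereal (blinfun_apply (\<Lambda> (w n)) (w n - u))) = ereal (c - blinfun_apply z u)"
    by (intro lim_imp_Limsup) auto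
  also have "\<dots> \<le> 0" using \<open>c \<le> blinfun_apply z u\<close> by simp
  finally have ls: "limsup (\<lambda>n. ereal (blinfun_apply (\<Lambda> (w n)) (w n - u))) \<le> 0" .
  have "weakly_tendsto w u" "\<forall>n. w n \<in> D" using u vD by (auto simp: w_def)
  with regular uD ls have li: "liminf (\<lambda>n. ereal (blinfun_apply (\<Lambda> (w n)) (w n))) \<ge> ereal (blinfun_apply (\<Lambda> u) u)"
    and \<Lambda>w: "weakly_tendsto (\<lambda>n. \<Lambda> (w n)) (\<Lambda> u)"
    unfolding pseudo_regular_def by blast+
  have z_eq: "z = \<Lambda> u"
    by (rule blinfun_eqI) (rule LIMSEQ_unique[OF weakly_tendsto_dualD[OF z] weakly_tendsto_dualD[OF \<Lambda>w, unfolded w_def]])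
  have "liminf (\<lambda>n. ereal (blinfun_apply (\<Lambda> (w n)) (w n))) = ereal c"
    using c by (intro lim_imp_Liminf) (auto simp: w_def)
  with li have "blinfun_apply z u \<le> c" by (simp add: z_eq)
  with cy have "(norm (y - u))\<^sup>2 \<le> 0" by linarith
  then have "y = u" by simp
  with y have "(u, - \<Lambda> u) \<in> graph" by (simp add: J_zero z_eq)
  with uD show ?thesis by blast
qed

end

theorem theorem5p3:
  fixes L :: "'a::banach \<times> ('a \<Rightarrow>\<^sub>L real) \<Rightarrow> ereal"
    and D :: "'a set"
    and \<Lambda> J :: "'a \<Rightarrow> ('a \<Rightarrow>\<^sub>L real)"
    and C :: real
  assumes "reflexive_space TYPE('a)"
    and "is_duality_map J"
    and "antiselfdual_lagrangian L"
    and "(0, 0) \<in> Dom L"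
    and "closed (Dom1 L)"
    and "bounded_map D \<Lambda>"
    and "pseudo_regular D \<Lambda>"
    and "Dom1 L \<subseteq> D"
    and "Lambda_coercive J D \<Lambda> L"
    and "C > 0"
    and "\<exists>R. \<forall>x. norm x \<ge> R \<longrightarrow>
           (\<forall>p\<in>bar_partial L x. blinfun_apply (p + \<Lambda> x) x \<ge> - C * (norm x + 1))"
  shows "\<exists>u. energy D \<Lambda> L u = (INF x. energy D \<Lambda> L x) \<and>
             (INF x. energy D \<Lambda> L x) = 0 \<and>
             u \<in> D \<and> - \<Lambda> u \<in> bar_partial L u"
proof -
  interpret asd_lagrangian L J using assms(1-3) by unfold_locales
  obtain R where R: "\<And>x p. R \<le> norm x \<Longrightarrow> p \<in> bar_partial L x \<Longrightarrow> - C * (norm x + 1) \<le> blinfun_apply (p + \<Lambda> x) x"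
    using assms(11) by blast
  have "\<exists>u. (u, - (\<Lambda> u + (1 / real n) *\<^sub>R J u)) \<in> graph" if "1 \<le> n" for n
    using that R assms(10)
    by (intro regularized_inclusion_exists[OF assms(4,5,6,7,8), of R C]) (auto simp: graph_iff_bar_partial)
  then obtain w where w: "\<And>n. 1 \<le> n \<Longrightarrow> (w n, - (\<Lambda> (w n) + (1 / real n) *\<^sub>R J (w n))) \<in> graph"
    by metis
  have wD: "w n \<in> D" if "1 \<le> n" for n
    using w[OF that] assms(8) by (auto simp: graph_def Dom1_def Dom_def)
  have "bounded (w ` {1..})" by (rule regularized_solutions_bounded[OF assms(9) wD w])
  \<comment> \<open>Only indices from 1 on are solutions; the shift by \<open>Suc\<close> matches
    the weights in \<open>regularized_limit\<close>.\<close>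
  then have "bounded (range (\<lambda>n. w (Suc n)))" by (rule bounded_subset) auto
  moreover have "(w (Suc n), - (\<Lambda> (w (Suc n)) + (1 / real (Suc n)) *\<^sub>R J (w (Suc n)))) \<in> graph" for n
    by (rule w) simp
  ultimately obtain u where u: "u \<in> D" "(u, - \<Lambda> u) \<in> graph"
    using regularized_limit[OF assms(5,6,7,8)] by blast
  have nonneg: "0 \<le> energy D \<Lambda> L x" for x
  proof (cases "(x, \<Lambda> x) \<in> Dom L")
    case True
    then show ?thesis using lag_ge[OF True] by (auto simp: energy_def L_eq_lag zero_ereal_def)
  next
    case False
    then show ?thesis by (auto simp: energy_def Dom_def)
  qed
  have "(u, \<Lambda> u) \<in> Dom L" "lag (u, \<Lambda> u) = - blinfun_apply (\<Lambda> u) u"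
    using u(2) lag_ge[of u "\<Lambda> u"] by (auto simp: graph_def blinfun.minus_left)
  then have zero: "energy D \<Lambda> L u = 0" using u(1) by (simp add: energy_def L_eq_lag zero_ereal_def)
  have "(INF x. energy D \<Lambda> L x) = 0"
  proof (rule antisym)
    show "(INF x. energy D \<Lambda> L x) \<le> 0" using INF_lower[of u UNIV "energy D \<Lambda> L"] zero by simp
    show "0 \<le> (INF x. energy D \<Lambda> L x)" using nonneg by (rule INF_greatest)
  qed
  then show ?thesis using zero u by (auto simp: graph_iff_bar_partial)
qed

end
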